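(* Let $A\in\mathbb{R}^{n\times n}$ be Hurwitz, $B\in\mathbb{R}^{n\times m}$, $C\in\mathbb{R}^{p\times n}$, let $F(s)=C(sI_n-A)^{-1}B$, and put $\mho:=BB^{\mathrm T}$, $\Omega:=C^{\mathrm T}C$. For $\theta<\|F\|_\infty^{-2}$, let $\Psi(\theta)$ be the unique stabilising solution of the algebraic Riccati equation $$A^{\mathrm T}\Psi(\theta)+\Psi(\theta)A+\theta\Omega+\Psi(\theta)\mho\Psi(\theta)=0 .$$ Then the derivatives $\Psi_k:=\Psi^{(k)}(0)$ with respect to $\theta$ satisfy the recurrence equation $$\Psi_k=\mathcal{L}_{A^{\mathrm T}}(\Omega_k),\qquad \Omega_k:=\delta_{k1}\Omega+\sum_{j=1}^{k-1}\binom{k}{j}\Psi_j\mho\Psi_{k-j},\qquad k\in\mathbb{N}.$$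
   Context: $\|F\|_\infty:=\operatorname{ess\,sup}_{\omega\in\mathbb{R}}\|F(i\omega)\|$ (operator norm), and $F$ is not identically zero. A stabilising solution of the Riccati equation is a real symmetric matrix $\Psi(\theta)$ of order $n$ such that $A+\mho\Psi(\theta)$ is Hurwitz. For $\theta<\|F\|_\infty^{-2}$ it exists, is unique, is infinitely differentiable in $\theta$, and satisfies $\Psi(0)=0$. For a Hurwitz matrix $M\in\mathbb{R}^{n\times n}$, $\mathcal{L}_M(V):=\int_0^\infty e^{tM}Ve^{tM^{\mathrm T}}dt$, so that $\mathcal{L}_{A^{\mathrm T}}(V)$ is the unique solution $X$ of $A^{\mathrm T}X+XA+V=0$. $\delta_{jk}$ is the Kronecker delta, $\mathbb{N}$ is the set of positive integers, and the empty sum (for $k=1$) is zero. *)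

theory Defs
  imports "HOL-Analysis.Analysis" "HOL-Probability.Essential_Supremum"
begin

definition complex_mat :: "real^'n^'m \<Rightarrow> complex^'n^'m" where
  "complex_mat M = map_matrix complex_of_real M"

definition hurwitz :: "real^'n^'n \<Rightarrow> bool" where
  "hurwitz M \<longleftrightarrow>
     (\<forall>(l::complex) (v::complex^'n). v \<noteq> 0 \<longrightarrow> complex_mat M *v v = l *s v \<longrightarrow> Re l < 0)"

definition transfer_function ::
  "real^'n^'n \<Rightarrow> real^'m^'n \<Rightarrow> real^'n^'p \<Rightarrow> complex \<Rightarrow> complex^'m^'p" where
  "transfer_function A B C s =
     complex_mat C ** matrix_inv (mat s - complex_mat A) ** complex_mat B"

text \<open>The norm on \<^typ>\<open>complex^'m\<close> is the Hermitian Euclidean norm, so \<^const>\<open>onorm\<close> below is the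
  usual operator norm (largest singular value) of a complex matrix. The norm takes values in
  \<^typ>\<open>ereal\<close>, where \<open>inverse 0 = \<infinity>\<close> and \<open>inverse \<infinity> = 0\<close>.\<close>

definition hinf_norm :: "(complex \<Rightarrow> complex^'m^'p) \<Rightarrow> ereal" where
  "hinf_norm F = esssup lborel (\<lambda>\<omega>::real. ereal (onorm (\<lambda>x. F (\<i> * complex_of_real \<omega>) *v x)))"

text \<open>On \<^typ>\<open>real^'n^'n\<close> the library operations \<open>(*)\<close> and \<open>(^)\<close> act componentwise, and \<^const>\<open>exp\<close> is not
  available since the type is not an instance of a normed algebra with the matrix product.\<close>

definition mat_exp :: "real^'n^'n \<Rightarrow> real^'n^'n" where
  "mat_exp M = (\<Sum>k. (1 / fact k) *\<^sub>R (((**) M ^^ k) (mat 1)))"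

definition lyapunov_op :: "real^'n^'n \<Rightarrow> real^'n^'n \<Rightarrow> real^'n^'n" where
  "lyapunov_op M V =
     integral {0..} (\<lambda>t. mat_exp (t *\<^sub>R M) ** V ** mat_exp (t *\<^sub>R transpose M))"

definition stabilising_solution ::
  "real^'n^'n \<Rightarrow> real^'m^'n \<Rightarrow> real^'n^'p \<Rightarrow> real \<Rightarrow> real^'n^'n \<Rightarrow> bool" where
  "stabilising_solution A B C \<theta> X \<longleftrightarrow>
     transpose X = X \<and>
     transpose A ** X + X ** A + \<theta> *\<^sub>R (transpose C ** C) + X ** (B ** transpose B) ** X = 0 \<and>
     hurwitz (A + (B ** transpose B) ** X)"

definition nth_vderiv :: "nat \<Rightarrow> (real \<Rightarrow> 'a::real_normed_vector) \<Rightarrow> real \<Rightarrow> 'a" where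
  "nth_vderiv k f = ((\<lambda>g t. vector_derivative g (at t)) ^^ k) f"

end

theory Submission
  imports Defs "HOL-Computational_Algebra.Fundamental_Theorem_Algebra"
begin

text \<open>Any two solutions \<open>X, Y\<close> of Riccati equations with parameters \<open>x, y\<close> satisfy the Sylvester
  equation \<open>(A\<^sup>T + X\<mho>)(X - Y) + (X - Y)(A + \<mho>Y) = - (x - y)\<Omega>\<close>, and Sylvester equations with Hurwitz
  coefficients are uniquely solvable because \<open>e\<^sup>t\<^sup>M\<close> decays. At equal parameters this identifies \<open>\<Psi>\<close> near 0
  with the continuous solution branch through 0 supplied by the inverse function theorem. At different
  parameters it turns continuity of \<open>\<Psi>\<close> into differentiability. Differentiating the Riccati equation \<open>k\<close> times
  gives a Sylvester equation for \<open>\<Psi>\<^sup>(\<^sup>k\<^sup>)\<close> whose right-hand side involves lower derivatives only, so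
  differentiability propagates to every order; at 0, where \<open>\<Psi>\<close> vanishes, it is the Lyapunov equation for
  \<open>\<Psi>\<^sub>k\<close>. The H-infinity norm is finite since the resolvent is bounded in the closed right half-plane,
  so \<open>\<Psi>\<close> is given on a neighbourhood of 0.\<close>

section \<open>Matrix products, transposition and complexification as bounded maps\<close>

lemma bounded_bilinear_matrix_mult:
  "bounded_bilinear ((**) :: 'a::{euclidean_space,real_algebra_1}^'n^'m \<Rightarrow> 'a^'p^'n \<Rightarrow> 'a^'p^'m)"
  unfolding bilinear_conv_bounded_bilinear[symmetric] bilinear_def
  by (auto intro!: linearI simp: vec_eq_iff matrix_matrix_mult_def algebra_simps sum.distrib
      scaleR_sum_right)

lemma bounded_bilinear_matrix_vector_mult:
  "bounded_bilinear ((*v) :: 'a::{euclidean_space,real_algebra_1}^'n^'m \<Rightarrow> 'a^'n \<Rightarrow> 'a^'m)"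
  unfolding bilinear_conv_bounded_bilinear[symmetric] bilinear_def
  by (auto intro!: linearI simp: vec_eq_iff matrix_vector_mult_def algebra_simps sum.distrib
      scaleR_sum_right)

lemmas tendsto_matrix_mult [tendsto_intros] =
  bounded_bilinear.tendsto[OF bounded_bilinear_matrix_mult]
lemmas has_vector_derivative_matrix_mult =
  bounded_bilinear.has_vector_derivative[OF bounded_bilinear_matrix_mult]

lemma bounded_linear_transpose:
  "bounded_linear (transpose :: 'a::euclidean_space^'n^'m \<Rightarrow> 'a^'m^'n)"
  unfolding linear_conv_bounded_linear[symmetric]
  by (auto intro!: linearI simp: vec_eq_iff transpose_def)

lemma bounded_linear_complex_mat: "bounded_linear (complex_mat :: real^'n^'m \<Rightarrow> complex^'n^'m)"
  unfolding linear_conv_bounded_linear[symmetric]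
  by (auto intro!: linearI simp: vec_eq_iff complex_mat_def complex_eq_iff)

lemma complex_mat_mult: "complex_mat (X ** Y) = complex_mat X ** complex_mat Y"
  by (simp add: complex_mat_def vec_eq_iff matrix_matrix_mult_def)

section \<open>The matrix exponential\<close>

abbreviation matpow :: "real^'n^'n \<Rightarrow> nat \<Rightarrow> real^'n^'n" where
  "matpow M k \<equiv> ((**) M ^^ k) (mat 1)"

lemma matpow_commute: "matpow M k ** M = M ** matpow M k"
  by (induction k) (simp_all add: matrix_mul_assoc[symmetric])

lemma matpow_scaleR: "matpow (t *\<^sub>R M) k = t ^ k *\<^sub>R matpow M k"
  by (induction k)
    (simp_all add: bounded_bilinear.scaleR_left[OF bounded_bilinear_matrix_mult]
      bounded_bilinear.scaleR_right[OF bounded_bilinear_matrix_mult])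

text \<open>Bounded bilinearity bounds each product up to a constant factor, which is absorbed into
  the base of the geometric bound. The factor \<open>norm (mat 1)\<close> stays because the
  Euclidean norm of the identity need not be 1.\<close>

lemma norm_matpow_le:
  fixes M :: "real^'n^'n"
  obtains K where "K \<ge> 0" "\<And>k. norm (matpow M k) \<le> norm (mat 1 :: real^'n^'n) * K ^ k"
proof -
  obtain K where K: "K > 0" "\<And>(X::real^'n^'n) (Y::real^'n^'n). norm (X ** Y) \<le> norm X * norm Y * K"
    using bounded_bilinear.pos_bounded[OF bounded_bilinear_matrix_mult] by blast
  have "norm (matpow M k) \<le> norm (mat 1 :: real^'n^'n) * (norm M * K) ^ k" for k
  proof (induction k)
    case (Suc k)
    have "norm (matpow M (Suc k)) \<le> norm (matpow M k) * (norm M * K)"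
      using K(2)[of M "matpow M k"] by (simp add: mult_ac)
    also have "\<dots> \<le> norm (mat 1 :: real^'n^'n) * (norm M * K) ^ k * (norm M * K)"
      using Suc K(1) by (intro mult_right_mono) auto
    finally show ?case by (simp add: mult_ac)
  qed simp
  then show thesis
    using that[of "norm M * K"] K(1) by simp
qed

text \<open>Entries of the exponential are treated as scalar power series in \<open>t\<close>, so
  that termwise differentiation applies. The comparison series is a multiple of that of the scalar
  exponential at \<open>K * \<bar>t\<bar>\<close>.\<close>

lemma summable_matpow_entry:
  fixes M :: "real^'n^'n"
  shows "summable (\<lambda>k. (matpow M k $ i $ j / fact k) * t ^ k)"
proof -
  obtain K where K: "K \<ge> 0" "\<And>k. norm (matpow M k) \<le> norm (mat 1 :: real^'n^'n) * K ^ k"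
    using norm_matpow_le[of M] by metis
  have "norm ((matpow M k $ i $ j / fact k) * t ^ k)
      \<le> norm (mat 1 :: real^'n^'n) * (inverse (fact k) * (K * \<bar>t\<bar>) ^ k)" for k
  proof -
    have "\<bar>matpow M k $ i $ j\<bar> \<le> norm (matpow M k)"
      by (metis Finite_Cartesian_Product.norm_nth_le order_trans real_norm_def)
    also note K(2)
    finally have "\<bar>matpow M k $ i $ j\<bar> * (inverse (fact k) * \<bar>t\<bar> ^ k)
        \<le> norm (mat 1 :: real^'n^'n) * K ^ k * (inverse (fact k) * \<bar>t\<bar> ^ k)"
      by (intro mult_right_mono) auto
    then show ?thesis
      by (simp add: abs_mult power_abs divide_inverse power_mult_distrib mult_ac)
  qed
  then show ?thesis
    by (intro summable_comparison_test'[OF summable_mult[OF summable_exp]]) auto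
qed

lemma mat_exp_nth:
  fixes M :: "real^'n^'n"
  shows "mat_exp (t *\<^sub>R M) $ i $ j = (\<Sum>k. (matpow M k $ i $ j / fact k) * t ^ k)"
proof -
  let ?f = "\<lambda>k. (1 / fact k) *\<^sub>R matpow (t *\<^sub>R M) k"
  have "?f sums (\<chi> i j. \<Sum>k. (matpow M k $ i $ j / fact k) * t ^ k)"
    unfolding sums_def
  proof (intro vec_tendstoI)
    fix i j
    have "(\<lambda>k. ?f k $ i $ j) = (\<lambda>k. (matpow M k $ i $ j / fact k) * t ^ k)"
      by (simp add: matpow_scaleR fun_eq_iff field_simps)
    then have "(\<lambda>k. ?f k $ i $ j) sums (\<Sum>k. (matpow M k $ i $ j / fact k) * t ^ k)"
      using summable_matpow_entry[of M i j t] by (simp add: summable_sums)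
    then show "(\<lambda>n. sum ?f {..<n} $ i $ j) \<longlonglongrightarrow> (\<chi> i j. \<Sum>k. (matpow M k $ i $ j / fact k) * t ^ k) $ i $ j"
      by (simp add: sums_def)
  qed
  then show ?thesis
    unfolding mat_exp_def by (simp add: sums_iff)
qed

lemma mat_exp_zero: "mat_exp (0 :: real^'n^'n) = mat 1"
proof -
  have "mat_exp (0 *\<^sub>R M) = mat 1" for M :: "real^'n^'n"
    unfolding vec_eq_iff mat_exp_nth by (subst powser_zero) simp
  then show ?thesis by simp
qed

lemma has_vector_derivative_vecI:
  fixes f :: "real \<Rightarrow> ('a::real_normed_vector)^'n"
  assumes "\<And>i. ((\<lambda>t. f t $ i) has_vector_derivative f' $ i) (at t)"
  shows "(f has_vector_derivative f') (at t)"
  unfolding has_vector_derivative_def has_derivative_at2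
proof (intro conjI bounded_linear_scaleR_left)
  show "((\<lambda>y. (1 / norm (y - t)) *\<^sub>R (f y - (f t + (y - t) *\<^sub>R f'))) \<longlongrightarrow> 0) (at t)"
    using assms unfolding has_vector_derivative_def has_derivative_at2
    by (intro vec_tendstoI) simp
qed

lemma mat_exp_has_vector_derivative:
  fixes M :: "real^'n^'n"
  shows "((\<lambda>t. mat_exp (t *\<^sub>R M)) has_vector_derivative M ** mat_exp (t *\<^sub>R M)) (at t)"
proof (intro has_vector_derivative_vecI)
  fix i j
  let ?c = "\<lambda>i j k. matpow M k $ i $ j / fact k"
  \<comment> \<open>Differentiation shifts the coefficients by one. The additional power of
    \<open>M\<close> splits off on the left and becomes the factor \<open>M\<close> of the
    derivative.\<close>
  have "diffs (?c i j) k * t ^ k = (\<Sum>l\<in>UNIV. M $ i $ l * (?c l j k * t ^ k))" for k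
  proof -
    have "diffs (?c i j) k = matpow M (Suc k) $ i $ j / fact k"
      by (simp add: diffs_def divide_simps)
    also have "\<dots> = (\<Sum>l\<in>UNIV. M $ i $ l * ?c l j k)"
      by (simp add: matrix_matrix_mult_def sum_divide_distrib)
    finally show ?thesis
      by (simp add: sum_distrib_right sum_distrib_left mult_ac)
  qed
  then have "(\<Sum>k. diffs (?c i j) k * t ^ k) = (\<Sum>k. \<Sum>l\<in>UNIV. M $ i $ l * (?c l j k * t ^ k))"
    by presburger
  also have "\<dots> = (\<Sum>l\<in>UNIV. \<Sum>k. M $ i $ l * (?c l j k * t ^ k))"
    by (intro suminf_sum summable_mult summable_matpow_entry)
  also have "\<dots> = (\<Sum>l\<in>UNIV. M $ i $ l * (\<Sum>k. ?c l j k * t ^ k))"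
    by (intro sum.cong refl suminf_mult summable_matpow_entry)
  also have "\<dots> = (M ** mat_exp (t *\<^sub>R M)) $ i $ j"
    by (simp add: matrix_matrix_mult_def mat_exp_nth)
  finally have "(\<Sum>k. diffs (?c i j) k * t ^ k) = (M ** mat_exp (t *\<^sub>R M)) $ i $ j" .
  then show "((\<lambda>t. mat_exp (t *\<^sub>R M) $ i $ j) has_vector_derivative (M ** mat_exp (t *\<^sub>R M)) $ i $ j) (at t)"
    using termdiffs_strong_converges_everywhere[OF summable_matpow_entry[of M i j], of t]
    by (simp add: mat_exp_nth has_real_derivative_iff_has_vector_derivative)
qed

text \<open>Every power of \<open>M\<close> commutes with \<open>M\<close>; what remains is to
  exchange the finite sum of the matrix product with the exponential series in each entry.\<close>

lemma mat_exp_commute: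
  fixes M :: "real^'n^'n"
  shows "mat_exp (t *\<^sub>R M) ** M = M ** mat_exp (t *\<^sub>R M)"
proof -
  let ?s = "\<lambda>i j k. matpow M k $ i $ j / fact k * t ^ k"
  have "(\<Sum>l\<in>UNIV. ?s i l k * M $ l $ j) = (\<Sum>l\<in>UNIV. M $ i $ l * ?s l j k)" for i j k
  proof -
    have "(\<Sum>l\<in>UNIV. ?s i l k * M $ l $ j) = (matpow M k ** M) $ i $ j / fact k * t ^ k"
      by (simp add: matrix_matrix_mult_def sum_distrib_right sum_distrib_left sum_divide_distrib mult_ac)
    also have "\<dots> = (M ** matpow M k) $ i $ j / fact k * t ^ k"
      by (simp only: matpow_commute)
    also have "\<dots> = (\<Sum>l\<in>UNIV. M $ i $ l * ?s l j k)"
      by (simp add: matrix_matrix_mult_def sum_distrib_right sum_distrib_left sum_divide_distrib mult_ac)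
    finally show ?thesis .
  qed
  note eq = this
  have "(mat_exp (t *\<^sub>R M) ** M) $ i $ j = (M ** mat_exp (t *\<^sub>R M)) $ i $ j" for i j
  proof -
    have "(mat_exp (t *\<^sub>R M) ** M) $ i $ j = (\<Sum>l\<in>UNIV. (\<Sum>k. ?s i l k) * M $ l $ j)"
      by (simp add: matrix_matrix_mult_def mat_exp_nth)
    also have "\<dots> = (\<Sum>l\<in>UNIV. \<Sum>k. ?s i l k * M $ l $ j)"
      by (intro sum.cong refl suminf_mult2 summable_matpow_entry)
    also have "\<dots> = (\<Sum>k. \<Sum>l\<in>UNIV. ?s i l k * M $ l $ j)"
      by (intro suminf_sum[symmetric] summable_mult2 summable_matpow_entry)
    also have "\<dots> = (\<Sum>k. \<Sum>l\<in>UNIV. M $ i $ l * ?s l j k)"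
      unfolding eq ..
    also have "\<dots> = (\<Sum>l\<in>UNIV. \<Sum>k. M $ i $ l * ?s l j k)"
      by (intro suminf_sum summable_mult summable_matpow_entry)
    also have "\<dots> = (\<Sum>l\<in>UNIV. M $ i $ l * (\<Sum>k. ?s l j k))"
      by (intro sum.cong refl suminf_mult summable_matpow_entry)
    also have "\<dots> = (M ** mat_exp (t *\<^sub>R M)) $ i $ j"
      by (simp add: matrix_matrix_mult_def mat_exp_nth)
    finally show ?thesis .
  qed
  then show ?thesis
    by (simp add: vec_eq_iff)
qed

section \<open>The resolvent of a Hurwitz matrix in the closed right half-plane\<close>

lemma norm_vector_smult: "norm (l *s v) = norm l * norm (v :: complex^'n)"
  by (simp add: norm_vec_def norm_mult L2_set_right_distrib)

lemma bounded_bilinear_vector_smult: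
  "bounded_bilinear ((*s) :: complex \<Rightarrow> complex^'n \<Rightarrow> complex^'n)"
  unfolding bilinear_conv_bounded_bilinear[symmetric] bilinear_def
  by (auto intro!: linearI simp: vec_eq_iff algebra_simps)

lemma matrix_vector_mult_smult: "N *v (l *s v) = l *s (N *v v)" for N :: "complex^'n^'m"
  by (simp add: vec_eq_iff matrix_vector_mult_def sum_distrib_left mult_ac)

text \<open>There is no eigenvalue with \<open>Re l \<ge> 0\<close>, so the right-hand side is
  positive for unit vectors, and by compactness uniformly so for bounded \<open>l\<close>. For large
  \<open>l\<close> the term \<open>l *s v\<close> dominates. Homogeneity in \<open>v\<close> does
  the rest.\<close>

lemma hurwitz_resolvent_bound:
  fixes M :: "real^'n^'n"
  assumes "hurwitz M"
  obtains c where "c > 0"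
    "\<And>l v. Re l \<ge> 0 \<Longrightarrow> c * norm v \<le> norm (l *s v - complex_mat M *v v)"
proof -
  let ?N = "complex_mat M"
  define f where "f = (\<lambda>(l, v). norm (l *s v - ?N *v v))"
  obtain K where K: "K > 0" "\<And>v. norm (?N *v v) \<le> norm v * K"
    using bounded_linear.pos_bounded[OF matrix_vector_mul_bounded_linear[of ?N]] by blast
  \<comment> \<open>Outside the radius \<open>K + 1\<close> the difference has norm at least
    \<open>norm v\<close>. Hence only this compact part needs a minimum, and the constant
    \<open>c\<close> below is capped at 1.\<close>
  define S where "S = ({l. Re l \<ge> 0} \<inter> cball 0 (K + 1)) \<times> sphere (0 :: complex^'n) 1"
  have "compact S"
    unfolding S_def by (intro compact_Times closed_Int_compact closed_halfspace_Re_ge) auto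
  moreover have "(0, axis undefined 1) \<in> S"
    using K(1) by (simp add: S_def norm_axis_1)
  then have "S \<noteq> {}" by blast
  moreover have "continuous_on S f"
    unfolding f_def case_prod_unfold
    by (intro continuous_intros bounded_bilinear.continuous_on[OF bounded_bilinear_vector_smult]
        bounded_linear.continuous_on[OF matrix_vector_mul_bounded_linear])
  ultimately obtain x0 where x0: "x0 \<in> S" "\<And>x. x \<in> S \<Longrightarrow> f x0 \<le> f x"
    using continuous_attains_inf[of S f] by metis
  have "f x0 > 0"
  proof -
    obtain l v where lv: "x0 = (l, v)" by (cases x0)
    then have lv: "x0 = (l, v)" "Re l \<ge> 0" "norm v = 1"
      using x0(1) unfolding S_def by simp_all
    have "v \<noteq> 0" using lv(3) by auto
    then have "?N *v v \<noteq> l *s v"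
      using assms lv(2) unfolding hurwitz_def by (metis not_less)
    then show ?thesis by (simp add: f_def lv(1))
  qed
  define c where "c = min (f x0) 1"
  show thesis
  proof (rule that)
    show "c > 0" using \<open>f x0 > 0\<close> by (simp add: c_def)
    fix l :: complex and v :: "complex^'n" assume l: "Re l \<ge> 0"
    show "c * norm v \<le> norm (l *s v - ?N *v v)"
    proof (cases "norm l \<le> K + 1 \<and> v \<noteq> 0")
      case True
      define w where "w = v /\<^sub>R norm v"
      have w: "norm w = 1" "norm v *\<^sub>R w = v"
        using True by (simp_all add: w_def)
      have "(l, w) \<in> S" using True l w by (simp add: S_def)
      then have "c \<le> norm (l *s w - ?N *v w)"
        using x0(2)[of "(l, w)"] by (simp add: c_def f_def)
      from mult_right_mono[OF this norm_ge_zero[of v]]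
      have "c * norm v \<le> norm (norm v *\<^sub>R (l *s w - ?N *v w))"
        by (simp add: mult.commute)
      also have "norm v *\<^sub>R (l *s w - ?N *v w) = l *s v - ?N *v v"
        unfolding scaleR_diff_right bounded_bilinear.scaleR_right[OF bounded_bilinear_matrix_vector_mult, symmetric]
          bounded_bilinear.scaleR_right[OF bounded_bilinear_vector_smult, symmetric] w(2) ..
      finally show ?thesis .
    next
      case False
      show ?thesis
      proof (cases "v = 0")
        case False
        then have "norm l > K + 1" using \<open>\<not> (norm l \<le> K + 1 \<and> v \<noteq> 0)\<close> by simp
        then have "norm v * (K + 1) \<le> norm v * norm l"
          by (intro mult_left_mono) auto
        then have "norm v \<le> norm (l *s v) - norm (?N *v v)"
          using K(2)[of v] by (simp add: norm_vector_smult algebra_simps)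
        also have "\<dots> \<le> norm (l *s v - ?N *v v)" by (rule norm_triangle_ineq2)
        finally show ?thesis
          using mult_right_mono[of c 1 "norm v"] by (simp add: c_def)
      qed simp
    qed
  qed
qed

section \<open>Exponential decay\<close>

definition exp_decay :: "(real \<Rightarrow> 'a::real_normed_vector) \<Rightarrow> bool" where
  "exp_decay f \<longleftrightarrow> (\<exists>C c. c > 0 \<and> (\<forall>t\<ge>0. norm (f t) \<le> C * exp (- c * t)))"

lemma exp_decayI:
  assumes "c > 0" "\<And>t. t \<ge> 0 \<Longrightarrow> norm (f t) \<le> C * exp (- c * t)"
  shows "exp_decay f"
  using assms unfolding exp_decay_def by blast

text \<open>The cap \<open>d\<close> allows the decay rates of two functions to be put in order. It
  costs nothing, since a smaller rate gives a weaker bound once \<open>C \<ge> 0\<close>, which is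
  read off at \<open>t = 0\<close>.\<close>

lemma exp_decayE:
  assumes "exp_decay f" "d > 0"
  obtains C c where "C \<ge> 0" "c > 0" "c \<le> d" "\<And>t. t \<ge> 0 \<Longrightarrow> norm (f t) \<le> C * exp (- c * t)"
proof -
  obtain C c where C: "c > 0" "\<And>t. t \<ge> 0 \<Longrightarrow> norm (f t) \<le> C * exp (- c * t)"
    using assms(1) unfolding exp_decay_def by blast
  have "C \<ge> 0" using C(2)[of 0] norm_ge_zero[of "f 0"] by (simp del: norm_ge_zero)
  have "norm (f t) \<le> C * exp (- min c d * t)" if "t \<ge> 0" for t
    using C(2)[OF that] \<open>C \<ge> 0\<close> that
    by (smt (verit, best) exp_le_cancel_iff mult_left_mono mult_right_mono min_def minus_mult_left)
  then show thesis
    using that[of C "min c d"] C(1) assms(2) \<open>C \<ge> 0\<close> by auto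
qed

lemma exp_decay_mono:
  assumes "exp_decay f" "\<And>t. t \<ge> 0 \<Longrightarrow> norm (g t) \<le> K * norm (f t)"
  shows "exp_decay g"
proof -
  obtain C c where C: "C \<ge> 0" "c > 0" "\<And>t. t \<ge> 0 \<Longrightarrow> norm (f t) \<le> C * exp (- c * t)"
    using exp_decayE[OF assms(1) zero_less_one] by metis
  have "norm (g t) \<le> (\<bar>K\<bar> * C) * exp (- c * t)" if "t \<ge> 0" for t
  proof -
    have "norm (g t) \<le> \<bar>K\<bar> * norm (f t)"
      using assms(2)[OF that] by (smt (verit) mult_right_mono norm_ge_zero)
    also have "\<dots> \<le> \<bar>K\<bar> * (C * exp (- c * t))"
      by (intro mult_left_mono C that) auto
    finally show ?thesis by simp
  qed
  then show ?thesis using C(2) by (intro exp_decayI)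
qed

lemma exp_decay_add:
  assumes "exp_decay f" "exp_decay g"
  shows "exp_decay (\<lambda>t. f t + g t)"
proof -
  obtain C c where C: "C \<ge> 0" "c > 0" "\<And>t. t \<ge> 0 \<Longrightarrow> norm (f t) \<le> C * exp (- c * t)"
    using exp_decayE[OF assms(1) zero_less_one] by metis
  obtain D d where D: "D \<ge> 0" "d > 0" "d \<le> c" "\<And>t. t \<ge> 0 \<Longrightarrow> norm (g t) \<le> D * exp (- d * t)"
    using exp_decayE[OF assms(2) C(2)] by metis
  have "norm (f t + g t) \<le> (C + D) * exp (- d * t)" if "t \<ge> 0" for t
  proof -
    have "C * exp (- c * t) \<le> C * exp (- d * t)"
      using C(1) D(3) that by (intro mult_left_mono) (auto intro: mult_right_mono)
    then show ?thesis
      using norm_triangle_ineq[of "f t" "g t"] C(3)[OF that] D(4)[OF that]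
      by (simp add: distrib_right)
  qed
  then show ?thesis using D(2) by (intro exp_decayI)
qed

lemma exp_decay_zero: "exp_decay (\<lambda>t. 0)"
  by (rule exp_decayI[of 1 _ 0]) auto

lemma exp_decay_sum:
  "(\<And>i. i \<in> I \<Longrightarrow> exp_decay (f i)) \<Longrightarrow> exp_decay (\<lambda>t. \<Sum>i\<in>I. f i t)"
  by (induction I rule: infinite_finite_induct) (auto intro: exp_decay_zero exp_decay_add)

lemma exp_decay_matrix_mult:
  fixes f :: "real \<Rightarrow> 'a::{euclidean_space,real_algebra_1}^'n^'m" and g :: "real \<Rightarrow> 'a^'p^'n"
  assumes "exp_decay f" "exp_decay g"
  shows "exp_decay (\<lambda>t. f t ** g t)"
proof -
  obtain C c where C: "C \<ge> 0" "c > 0" "\<And>t. t \<ge> 0 \<Longrightarrow> norm (f t) \<le> C * exp (- c * t)"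
    using exp_decayE[OF assms(1) zero_less_one] by metis
  obtain K where K: "K > 0" "\<And>(a::'a^'n^'m) (b::'a^'p^'n). norm (a ** b) \<le> norm a * norm b * K"
    using bounded_bilinear.pos_bounded[OF bounded_bilinear_matrix_mult] by blast
  have "norm (f t ** g t) \<le> (C * K) * norm (g t)" if "t \<ge> 0" for t
  proof -
    have "exp (- c * t) \<le> 1" using C(2) that by simp
    then have "norm (f t) \<le> C"
      using C(1) C(3)[OF that] by (meson mult_left_le order_trans)
    then have "norm (f t) * norm (g t) * K \<le> C * norm (g t) * K"
      using K(1) by (intro mult_right_mono) auto
    then show ?thesis using K(2)[of "f t" "g t"] by (simp add: mult_ac)
  qed
  then show ?thesis by (rule exp_decay_mono[OF assms(2)])
qed

lemma exp_decay_tendsto: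
  assumes "exp_decay f"
  shows "(f \<longlongrightarrow> 0) at_top"
proof -
  obtain C c where C: "c > 0" "\<And>t. t \<ge> 0 \<Longrightarrow> norm (f t) \<le> C * exp (- c * t)"
    using assms unfolding exp_decay_def by blast
  have "filterlim (\<lambda>t. - c * t) at_bot at_top"
    using C(1) filterlim_tendsto_neg_mult_at_bot[OF tendsto_const _ filterlim_ident, of "- c"] by simp
  then have "((\<lambda>t. C * exp (- c * t)) \<longlongrightarrow> C * 0) at_top"
    by (intro tendsto_mult tendsto_const filterlim_compose[OF exp_at_bot])
  then show ?thesis
    using C(2) by (intro Lim_null_comparison[of f])
      (auto intro!: eventually_mono[OF eventually_ge_at_top[of 0]])
qed

text \<open>Variation of constants: with the integrating factor e^(-ta), the function
  \<open>w\<close> has derivative e^(-ta) g. Bounding the growth of \<open>w\<close> and multiplying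
  back by e^(ta) yields decay at the rate of the forcing term.\<close>

lemma exp_decay_linear_ode:
  fixes u :: "real \<Rightarrow> complex^'n"
  assumes u: "\<And>t. (u has_vector_derivative (a *s u t + g t)) (at t)"
    and "Re a < 0" "exp_decay g"
  shows "exp_decay u"
proof -
  define b where "b = - Re a"
  \<comment> \<open>The cap \<open>b / 2\<close> excludes resonance: \<open>b - d\<close> is
    positive, so the antiderivative of \<open>exp ((b - d) * t)\<close> is a multiple of itself
    without a factor \<open>t\<close>.\<close>
  obtain C d where C: "C \<ge> 0" "d > 0" "d \<le> b / 2" "\<And>t. t \<ge> 0 \<Longrightarrow> norm (g t) \<le> C * exp (- d * t)"
    using exp_decayE[OF assms(3), of "b / 2"] assms(2) by (auto simp: b_def)
  have bd: "b > d" using C b_def assms(2) by linarith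
  define w where "w = (\<lambda>t. exp (- of_real t * a) *s u t)"
  have w': "(w has_vector_derivative exp (- of_real t * a) *s g t) (at t)" for t
  proof -
    have "((\<lambda>t. exp (- of_real t * a)) has_vector_derivative (- a * exp (- of_real t * a))) (at t)"
      by (rule has_vector_derivative_real_field derivative_eq_intros refl | simp)+
    from bounded_bilinear.has_vector_derivative[OF bounded_bilinear_vector_smult this u]
    show ?thesis
      unfolding w_def
      by (rule has_vector_derivative_eq_rhs) (simp add: vec_eq_iff algebra_simps)
  qed
  have nexp: "norm (exp (- of_real t * a)) = exp (b * t)" for t
    by (simp add: b_def)
  define \<phi> where "\<phi> = (\<lambda>t. C / (b - d) * exp ((b - d) * t))"
  have \<phi>': "(\<phi> has_vector_derivative C * exp ((b - d) * t)) (at t)" for t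
    unfolding \<phi>_def has_real_derivative_iff_has_vector_derivative[symmetric]
    using bd by (auto intro!: derivative_eq_intros)
  \<comment> \<open>\<open>\<phi>\<close> is an antiderivative of the bound on the derivative of
    \<open>w\<close>, so the mean value inequality compares their increments.\<close>
  have main: "norm (w t - w 0) \<le> \<phi> t - \<phi> 0" if "t > 0" for t
  proof (rule differentiable_bound_general[OF that _ _ w' \<phi>'])
    show "continuous_on {0..t} w" "continuous_on {0..t} \<phi>"
      using w' \<phi>' by (meson continuous_at_imp_continuous_on has_vector_derivative_continuous)+
    fix s assume s: "0 < s" "s < t"
    have "norm (exp (- of_real s * a) *s g s) \<le> exp (b * s) * (C * exp (- d * s))"
      unfolding norm_vector_smult nexp using C(4)[of s] s by (intro mult_left_mono) auto
    also have "\<dots> = C * exp ((b - d) * s)"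
      by (simp add: algebra_simps exp_diff exp_minus field_simps)
    finally show "norm (exp (- of_real s * a) *s g s) \<le> C * exp ((b - d) * s)" .
  qed
  have "norm (u t) \<le> (norm (u 0) + C / (b - d)) * exp (- d * t)" if t: "t \<ge> 0" for t
  proof -
    have "norm (w t - w 0) \<le> \<phi> t"
      proof (cases "t = 0")
      case False
      have "\<phi> 0 \<ge> 0" using C(1) bd by (simp add: \<phi>_def)
      then show ?thesis using main[of t] t False by simp
    qed (use C(1) bd in \<open>simp add: \<phi>_def\<close>)
    then have "norm (w t) \<le> norm (u 0) + \<phi> t"
      using norm_triangle_sub[of "w t" "w 0"] by (simp add: w_def)
    then have "exp (- b * t) * norm (w t) \<le> exp (- b * t) * (norm (u 0) + \<phi> t)"
      by (intro mult_left_mono) auto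
    also have "exp (- b * t) * norm (w t) = norm (u t)"
      unfolding w_def norm_vector_smult nexp by (simp add: exp_minus)
    also have "exp (- b * t) * (norm (u 0) + \<phi> t) = exp (- b * t) * norm (u 0) + C / (b - d) * exp (- d * t)"
      by (simp add: \<phi>_def algebra_simps exp_diff exp_minus) (simp add: field_simps)
    also have "exp (- b * t) * norm (u 0) \<le> exp (- d * t) * norm (u 0)"
      using bd t by (intro mult_right_mono) (auto intro: mult_right_mono)
    finally show ?thesis by (simp add: algebra_simps)
  qed
  then show ?thesis using C(2) by (intro exp_decayI)
qed

section \<open>Decay of the exponential of a Hurwitz matrix\<close>

text \<open>The real exponential acts on complex vectors here because the roots of an annihilating
  polynomial are complex.\<close>

abbreviation flow :: "real^'n^'n \<Rightarrow> real \<Rightarrow> complex^'n \<Rightarrow> complex^'n" where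
  "flow M t v \<equiv> complex_mat (mat_exp (t *\<^sub>R M)) *v v"

lemma flow_commute: "flow M t (complex_mat M *v v) = complex_mat M *v flow M t v"
  by (simp add: matrix_vector_mul_assoc complex_mat_mult[symmetric] mat_exp_commute)

lemma flow_has_vector_derivative:
  "((\<lambda>t. flow M t v) has_vector_derivative complex_mat M *v flow M t v) (at t)"
proof -
  have "((\<lambda>t. complex_mat (mat_exp (t *\<^sub>R M))) has_vector_derivative
      complex_mat (M ** mat_exp (t *\<^sub>R M))) (at t)"
    by (intro bounded_linear.has_vector_derivative[OF bounded_linear_complex_mat]
        mat_exp_has_vector_derivative)
  then have "((\<lambda>t. flow M t v) has_vector_derivative
      complex_mat (M ** mat_exp (t *\<^sub>R M)) *v v) (at t)"
    by (intro bounded_linear.has_vector_derivative[OF bounded_bilinear.bounded_linear_left[OF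
          bounded_bilinear_matrix_vector_mult]])
  then show ?thesis
    by (simp add: complex_mat_mult matrix_vector_mul_assoc)
qed

text \<open>If \<open>Re a < 0\<close>, then \<open>u t = e\<^sup>t\<^sup>M v\<close> solves \<open>u' = a u + g\<close> with decaying \<open>g\<close>; otherwise \<open>a\<close> lies in the
  resolvent set and the resolvent bound applies. Splitting off one root of an annihilating polynomial
  at a time thus needs no Jordan form.\<close>

lemma hurwitz_flow_decay_step:
  assumes M: "hurwitz M"
    and w: "exp_decay (\<lambda>t. flow M t (complex_mat M *v v - a *s v))"
  shows "exp_decay (\<lambda>t. flow M t v)"
proof (cases "Re a < 0")
  case True
  have "complex_mat M *v flow M t v = a *s flow M t v + flow M t (complex_mat M *v v - a *s v)" for t
    by (simp add: matrix_vector_mult_diff_distrib flow_commute matrix_vector_mult_smult)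
  then have "((\<lambda>t. flow M t v) has_vector_derivative
      a *s flow M t v + flow M t (complex_mat M *v v - a *s v)) (at t)" for t
    by (metis flow_has_vector_derivative)
  then show ?thesis using exp_decay_linear_ode[OF _ True w] by blast
next
  case False
  obtain c where c: "c > 0"
    "\<And>l v. Re l \<ge> 0 \<Longrightarrow> c * norm v \<le> norm (l *s v - complex_mat M *v v)"
    using hurwitz_resolvent_bound[OF M] by blast
  have "norm (flow M t v) \<le> 1 / c * norm (flow M t (complex_mat M *v v - a *s v))" for t
  proof -
    have "c * norm (flow M t v) \<le> norm (a *s flow M t v - complex_mat M *v flow M t v)"
      using c(2) False by auto
    also have "\<dots> = norm (flow M t (complex_mat M *v v - a *s v))"
      by (simp add: matrix_vector_mult_diff_distrib flow_commute matrix_vector_mult_smult norm_minus_commute)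
    finally show ?thesis using c(1) by (simp add: field_simps)
  qed
  then show ?thesis by (intro exp_decay_mono[OF w])
qed

text \<open>This is p(N) v, formed from the Krylov sequence v, Nv, N(Nv), ... of a single vector;
  powers of \<open>N\<close> as matrices do not occur.\<close>

definition poly_act :: "complex^'n^'n \<Rightarrow> complex poly \<Rightarrow> complex^'n \<Rightarrow> complex^'n" where
  "poly_act N p v = (\<Sum>i\<le>degree p. coeff p i *s (((*v) N ^^ i) v))"

lemma poly_act_eq:
  assumes "degree p \<le> n"
  shows "poly_act N p v = (\<Sum>i\<le>n. coeff p i *s (((*v) N ^^ i) v))"
  unfolding poly_act_def using assms
  by (intro sum.mono_neutral_left) (auto simp: coeff_eq_0)

lemma poly_act_add: "poly_act N (p + q) v = poly_act N p v + poly_act N q v"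
proof -
  let ?n = "max (degree p) (degree q)"
  have "poly_act N r v = (\<Sum>i\<le>?n. coeff r i *s (((*v) N ^^ i) v))" if "r \<in> {p, q, p + q}" for r
    using that degree_add_le_max[of p q] by (intro poly_act_eq) auto
  then show ?thesis by (simp add: sum.distrib vector_sadd_rdistrib)
qed

lemma poly_act_smult: "poly_act N (smult a p) v = a *s poly_act N p v"
  by (subst poly_act_eq[OF degree_smult_le])
    (simp add: poly_act_def vec.scale_sum_right vector_smult_assoc)

text \<open>Multiplying \<open>p\<close> by the indeterminate shifts the coefficients, and the
  surplus application of \<open>N\<close> is moved to the innermost place.\<close>

lemma poly_act_pCons_0: "poly_act N (pCons 0 p) v = poly_act N p (N *v v)"
proof -
  have "degree (pCons 0 p) \<le> Suc (degree p)" by (simp add: degree_pCons_le)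
  from poly_act_eq[OF this] show ?thesis
    by (simp add: sum.atMost_Suc_shift funpow_swap1 poly_act_def del: sum.atMost_Suc funpow.simps(2))
      (simp add: funpow_Suc_right del: funpow.simps(2))
qed

lemma funpow_mult_linear:
  fixes N :: "complex^'n^'n"
  shows "((*v) N ^^ i) (v - a *s w) = ((*v) N ^^ i) v - a *s ((*v) N ^^ i) w"
  by (induction i) (simp_all add: matrix_vector_mult_diff_distrib matrix_vector_mult_smult)

lemma poly_act_diff_smult: "poly_act N p (v - a *s w) = poly_act N p v - a *s poly_act N p w"
  by (simp add: poly_act_def funpow_mult_linear vec.scale_right_diff_distrib sum_subtractf
      vec.scale_sum_right vector_smult_assoc mult.commute)

text \<open>Induction on the degree: a root \<open>a\<close> gives p = (x - a) q, so p(N) v =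
  q(N)(Nv - av). The induction hypothesis yields decay for Nv - av, and
  \<open>hurwitz_flow_decay_step\<close> passes from there to \<open>v\<close>.\<close>

lemma hurwitz_flow_decay_poly:
  assumes M: "hurwitz M" and "p \<noteq> 0"
    and "exp_decay (\<lambda>t. flow M t (poly_act (complex_mat M) p v))"
  shows "exp_decay (\<lambda>t. flow M t v)"
  using assms(2,3)
proof (induction "degree p" arbitrary: p v)
  case 0
  then obtain c where c: "p = [:c:]" "c \<noteq> 0"
    by (metis degree_eq_zeroE pCons_eq_0_iff)
  have "flow M t (poly_act (complex_mat M) p v) = c *s flow M t v" for t
    by (simp add: c poly_act_def matrix_vector_mult_smult)
  with 0(3) have "exp_decay (\<lambda>t. c *s flow M t v)" by simp
  then show ?case
    by (rule exp_decay_mono[where K = "1 / norm c"]) (simp add: norm_vector_smult c(2))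
next
  case (Suc d)
  then have "\<not> constant (poly p)" by (simp add: constant_degree)
  then obtain a where "poly p a = 0" using fundamental_theorem_of_algebra by blast
  then obtain q where q: "p = [:- a, 1:] * q" by (metis dvdE poly_eq_0_iff_dvd)
  then have "q \<noteq> 0" using Suc.prems by auto
  then have "d = degree q" using Suc.hyps(2) unfolding q by (subst (asm) degree_mult_eq) auto
  have "p = pCons 0 q + smult (- a) q" by (simp add: q)
  then have "poly_act (complex_mat M) p v = poly_act (complex_mat M) q (complex_mat M *v v - a *s v)"
    by (simp only: poly_act_add poly_act_smult poly_act_pCons_0 poly_act_diff_smult) simp
  with Suc.prems(2) have "exp_decay (\<lambda>t. flow M t (complex_mat M *v v - a *s v))"
    using Suc.hyps(1)[OF \<open>d = degree q\<close> \<open>q \<noteq> 0\<close>] by simp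
  then show ?case by (rule hurwitz_flow_decay_step[OF M])
qed

text \<open>One vector more than the dimension forces dependence. As the family is a sequence rather
  than a set, a repeated value is a separate case, settled by the coefficients 1 and -1.\<close>

lemma sequence_linearly_dependent:
  fixes f :: "nat \<Rightarrow> 'a::euclidean_space"
  obtains c where "\<exists>i\<le>DIM('a). c i \<noteq> 0" "(\<Sum>i\<le>DIM('a). c i *\<^sub>R f i) = 0"
proof (cases "inj_on f {..DIM('a)}")
  case True
  then have "card (f ` {..DIM('a)}) = Suc (DIM('a))" by (simp add: card_image)
  then have "dependent (f ` {..DIM('a)})" by (intro dependent_biggerset) auto
  then obtain u where "\<exists>v\<in>f ` {..DIM('a)}. u v \<noteq> 0" "(\<Sum>v\<in>f ` {..DIM('a)}. u v *\<^sub>R v) = 0"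
    by (auto simp: dependent_finite)
  then show ?thesis
    using that[of "u \<circ> f"] True by (auto simp: sum.reindex)
next
  case False
  then obtain i j where ij: "i \<le> DIM('a)" "j \<le> DIM('a)" "i \<noteq> j" "f i = f j"
    by (auto simp: inj_on_def)
  show ?thesis
  proof (rule that)
    let ?c = "\<lambda>k. if k = i then 1 else if k = j then - 1 else 0 :: real"
    show "\<exists>k\<le>DIM('a). ?c k \<noteq> 0" using ij(1) by auto
    have "(\<Sum>k\<le>DIM('a). ?c k *\<^sub>R f k) = (\<Sum>k\<in>{i, j}. ?c k *\<^sub>R f k)"
      using ij by (intro sum.mono_neutral_right) auto
    then show "(\<Sum>k\<le>DIM('a). ?c k *\<^sub>R f k) = 0" using ij by simp
  qed
qed

text \<open>The Krylov vectors up to the real dimension of the space are dependent over the reals;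
  the coefficients of that relation are those of \<open>p\<close>. The polynomial may depend on
  \<open>v\<close>.\<close>

lemma annihilating_poly:
  fixes N :: "complex^'n^'n"
  obtains p where "p \<noteq> 0" "poly_act N p v = 0"
proof -
  let ?d = "DIM(complex^'n)"
  obtain c where c: "\<exists>i\<le>?d. c i \<noteq> 0" "(\<Sum>i\<le>?d. c i *\<^sub>R ((*v) N ^^ i) v) = 0"
    using sequence_linearly_dependent[of "\<lambda>i. ((*v) N ^^ i) v"] by blast
  define p where "p = (\<Sum>i\<le>?d. monom (complex_of_real (c i)) i)"
  have co: "coeff p i = (if i \<le> ?d then of_real (c i) else 0)" for i
    by (simp add: p_def coeff_sum)
  show thesis
  proof (rule that)
    show "p \<noteq> 0" using c(1) co by (metis coeff_0 of_real_eq_0_iff)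
    have "degree p \<le> ?d" by (intro degree_le) (simp add: co)
    then have "poly_act N p v = (\<Sum>i\<le>?d. of_real (c i) *s ((*v) N ^^ i) v)"
      by (simp add: poly_act_eq co)
    also have "\<dots> = (\<Sum>i\<le>?d. c i *\<^sub>R ((*v) N ^^ i) v)"
      by (intro sum.cong refl) (simp add: vec_eq_iff complex_eq_iff)
    finally show "poly_act N p v = 0" using c(2) by simp
  qed
qed

lemma norm_le_sum_norm_nth: "norm x \<le> (\<Sum>i\<in>UNIV. norm (x $ i))" for x :: "'a::real_normed_vector^'n"
  unfolding norm_vec_def by (rule L2_set_le_sum) simp

text \<open>An annihilating polynomial sends \<open>v\<close> to 0, whose flow decays trivially, so
  the flow of every \<open>v\<close> decays. Unit vectors then give the columns of the exponential,
  and finitely many decaying entries bound the matrix norm.\<close>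

lemma hurwitz_mat_exp_decay:
  fixes M :: "real^'n^'n"
  assumes "hurwitz M"
  shows "exp_decay (\<lambda>t. mat_exp (t *\<^sub>R M))"
proof -
  have flow: "exp_decay (\<lambda>t. flow M t v)" for v
  proof -
    obtain p where p: "p \<noteq> 0" "poly_act (complex_mat M) p v = 0"
      using annihilating_poly by blast
    show ?thesis
      by (rule hurwitz_flow_decay_poly[OF assms p(1)]) (simp add: p(2) exp_decay_zero)
  qed
  have entry: "exp_decay (\<lambda>t. mat_exp (t *\<^sub>R M) $ i $ j)" for i j
  proof (rule exp_decay_mono[OF flow[of "axis j 1"], of _ 1])
    fix t
    have "flow M t (axis j 1) $ i = complex_of_real (mat_exp (t *\<^sub>R M) $ i $ j)"
      by (simp add: matrix_vector_mult_def axis_def complex_mat_def if_distrib cong: if_cong)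
    then show "norm (mat_exp (t *\<^sub>R M) $ i $ j) \<le> 1 * norm (flow M t (axis j 1))"
      using Finite_Cartesian_Product.norm_nth_le[of "flow M t (axis j 1)" i] by simp
  qed
  have "exp_decay (\<lambda>t. norm (mat_exp (t *\<^sub>R M) $ i $ j))" for i j
    by (rule exp_decay_mono[OF entry[of i j], of _ 1]) simp
  then have "exp_decay (\<lambda>t. \<Sum>i\<in>UNIV. \<Sum>j\<in>UNIV. norm (mat_exp (t *\<^sub>R M) $ i $ j))"
    by (intro exp_decay_sum)
  then show ?thesis
  proof (rule exp_decay_mono[of _ _ 1])
    fix t
    let ?X = "mat_exp (t *\<^sub>R M)"
    have "norm ?X \<le> (\<Sum>i\<in>UNIV. norm (?X $ i))" by (rule norm_le_sum_norm_nth)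
    also have "\<dots> \<le> (\<Sum>i\<in>UNIV. \<Sum>j\<in>UNIV. norm (?X $ i $ j))"
      by (intro sum_mono norm_le_sum_norm_nth)
    finally show "norm ?X \<le> 1 * norm (\<Sum>i\<in>UNIV. \<Sum>j\<in>UNIV. norm (?X $ i $ j))"
      by simp
  qed
qed

section \<open>Sylvester and Lyapunov equations\<close>

text \<open>Transposition reverses products, and \<open>matpow_commute\<close> turns the reversed
  product back into iterated left multiplication.\<close>

lemma mat_exp_transpose:
  fixes M :: "real^'n^'n"
  shows "mat_exp (t *\<^sub>R transpose M) = transpose (mat_exp (t *\<^sub>R M))"
proof -
  have "matpow (transpose M) k = transpose (matpow M k)" for k
  proof (induction k)
    case (Suc k)
    have "matpow (transpose M) (Suc k) = transpose M ** transpose (matpow M k)"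
      using Suc by simp
    also have "\<dots> = transpose (matpow M k ** M)"
      by (rule matrix_transpose_mul[symmetric])
    also have "\<dots> = transpose (matpow M (Suc k))"
      by (simp add: matpow_commute)
    finally show ?case .
  qed simp
  then show ?thesis by (simp add: vec_eq_iff mat_exp_nth transpose_def)
qed

lemma hurwitz_mat_exp_transpose_decay:
  fixes M :: "real^'n^'n"
  assumes "hurwitz M"
  shows "exp_decay (\<lambda>t. mat_exp (t *\<^sub>R transpose M))"
proof -
  obtain K where "\<And>X :: real^'n^'n. norm (transpose X) \<le> norm X * K"
    using bounded_linear.bounded[OF bounded_linear_transpose[where ?'a = real and ?'n = 'n and ?'m = 'n]] by metis
  then show ?thesis
    by (intro exp_decay_mono[OF hurwitz_mat_exp_decay[OF assms], of _ K])
      (simp add: mat_exp_transpose mult.commute)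
qed

text \<open>The Sylvester operator appears between the exponentials. A vanishing derivative gives
  uniqueness below; a prescribed one gives the integral formula.\<close>

lemma mat_exp_sandwich_has_vector_derivative:
  fixes P Q X :: "real^'n^'n"
  shows "((\<lambda>t. mat_exp (t *\<^sub>R P) ** X ** mat_exp (t *\<^sub>R Q)) has_vector_derivative
    mat_exp (t *\<^sub>R P) ** (P ** X + X ** Q) ** mat_exp (t *\<^sub>R Q)) (at t)"
proof -
  have "((\<lambda>t. mat_exp (t *\<^sub>R P) ** X) has_vector_derivative P ** mat_exp (t *\<^sub>R P) ** X) (at t)"
    by (rule bounded_linear.has_vector_derivative[OF bounded_bilinear.bounded_linear_left[OF
          bounded_bilinear_matrix_mult] mat_exp_has_vector_derivative])
  from has_vector_derivative_matrix_mult[OF this mat_exp_has_vector_derivative[of Q t]]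
  show ?thesis
    by (rule has_vector_derivative_eq_rhs)
      (simp add: matrix_add_ldistrib
        bounded_bilinear.add_left[OF bounded_bilinear_matrix_mult] matrix_mul_assoc mat_exp_commute)
qed

text \<open>The product e^(tP) X e^(tQ) has derivative zero, hence is constant; it equals
  \<open>X\<close> at \<open>t = 0\<close> and tends to 0 at infinity.\<close>

lemma sylvester_unique:
  fixes P Q X :: "real^'n^'n"
  assumes "exp_decay (\<lambda>t. mat_exp (t *\<^sub>R P))" "exp_decay (\<lambda>t. mat_exp (t *\<^sub>R Q))"
    and "P ** X + X ** Q = 0"
  shows "X = 0"
proof -
  let ?F = "\<lambda>t. mat_exp (t *\<^sub>R P) ** X ** mat_exp (t *\<^sub>R Q)"
  have "(?F has_vector_derivative 0) (at t)" for t
    using mat_exp_sandwich_has_vector_derivative[of P X Q t] assms(3) by simp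
  then obtain c where c: "\<And>t. ?F t = c"
    using has_vector_derivative_zero_constant[of UNIV ?F] by auto
  have "((\<lambda>t. ?F t) \<longlongrightarrow> 0 ** X ** 0) at_top"
    by (intro tendsto_matrix_mult exp_decay_tendsto assms tendsto_const)
  then have "c = 0" unfolding c by (simp add: tendsto_const_iff)
  then show ?thesis using c[of 0] by (simp add: mat_exp_zero)
qed

lemma hurwitz_sylvester_unique:
  fixes M N X :: "real^'n^'n"
  assumes "hurwitz M" "hurwitz N" "transpose M ** X + X ** N = 0"
  shows "X = 0"
  by (rule sylvester_unique[OF hurwitz_mat_exp_transpose_decay hurwitz_mat_exp_decay]) (fact assms)+

text \<open>By the equation for \<open>X\<close>, the integrand of \<open>lyapunov_op\<close> is the
  derivative of \<open>?F\<close>. The fundamental theorem of calculus on [0,k] and dominated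
  convergence with an exponential majorant give the improper integral.\<close>

lemma lyapunov_op_eqI:
  fixes A X V :: "real^'n^'n"
  assumes A: "hurwitz A" and X: "transpose A ** X + X ** A + V = 0"
  shows "lyapunov_op (transpose A) V = X"
proof -
  let ?E = "\<lambda>t. mat_exp (t *\<^sub>R A)" and ?T = "\<lambda>t. mat_exp (t *\<^sub>R transpose A)"
  let ?g = "\<lambda>t. ?T t ** V ** ?E t" and ?F = "\<lambda>t. - (?T t ** X ** ?E t)"
  have E: "exp_decay ?E" "exp_decay ?T"
    using A by (auto intro: hurwitz_mat_exp_decay hurwitz_mat_exp_transpose_decay)
  have V: "V = - (transpose A ** X + X ** A)"
    using X by (simp add: add_eq_0_iff)
  have F': "(?F has_vector_derivative ?g t) (at t)" for t
    using has_vector_derivative_minus[OF mat_exp_sandwich_has_vector_derivative[of "transpose A" X A t]]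
    unfolding V by (simp only: bounded_bilinear.minus_left[OF bounded_bilinear_matrix_mult]
        bounded_bilinear.minus_right[OF bounded_bilinear_matrix_mult])
  have int: "((\<lambda>t. if t \<in> {0..real k} then ?g t else 0) has_integral ?F (real k) - ?F 0) {0..}" for k
  proof -
    have "(?g has_integral ?F (real k) - ?F 0) {0..real k}"
      by (intro fundamental_theorem_of_calculus has_vector_derivative_at_within[OF F']) auto
    then show ?thesis by (subst has_integral_restrict) auto
  qed
  have "exp_decay (\<lambda>t. ?T t ** V)"
  proof -
    obtain K where "\<And>Y :: real^'n^'n. norm (Y ** V) \<le> norm Y * K"
      using bounded_linear.bounded[OF bounded_bilinear.bounded_linear_left[OF
          bounded_bilinear_matrix_mult, of V]] by metis
    then show ?thesis
      by (intro exp_decay_mono[OF E(2), of _ K]) (simp add: mult.commute)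
  qed
  then have "exp_decay ?g" by (rule exp_decay_matrix_mult[OF _ E(1)])
  from exp_decayE[OF this zero_less_one] obtain C c where C: "C \<ge> 0" "c > 0" "\<And>t. t \<ge> 0 \<Longrightarrow> norm (?g t) \<le> C * exp (- c * t)"
    by metis
  have "(?g has_integral X) {0..}"
  proof (rule has_integral_dominated_convergence[OF int, where h = "\<lambda>t. C * exp (- c * t)"])
    show "(\<lambda>t. C * exp (- c * t)) integrable_on {0..}"
      using integrable_on_exp_minus_to_infinity[OF C(2), of 0] by (rule integrable_on_mult_right)
    show "\<forall>t\<in>{0..}. norm (if t \<in> {0..real k} then ?g t else 0) \<le> C * exp (- c * t)" for k
      using C by auto
    show "\<forall>t\<in>{0..}. (\<lambda>k. if t \<in> {0..real k} then ?g t else 0) \<longlonglongrightarrow> ?g t"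
    proof
      fix t :: real assume t: "t \<in> {0..}"
      have "\<forall>\<^sub>F k in sequentially. (if t \<in> {0..real k} then ?g t else 0) = ?g t"
        using eventually_ge_at_top[of "nat \<lceil>t\<rceil>"]
        by eventually_elim (use t in \<open>auto simp: nat_le_iff ceiling_le_iff\<close>)
      then show "(\<lambda>k. if t \<in> {0..real k} then ?g t else 0) \<longlonglongrightarrow> ?g t"
        by (rule tendsto_eventually)
    qed
    \<comment> \<open>The boundary term at infinity vanishes by decay, and the one at 0 is
      \<open>- ?F 0 = X\<close>.\<close>
    have "(\<lambda>k. ?F (real k) - ?F 0) \<longlonglongrightarrow> - (0 ** X ** 0) - ?F 0"
      by (intro tendsto_diff tendsto_minus tendsto_matrix_mult tendsto_const
          filterlim_compose[OF exp_decay_tendsto filterlim_real_sequentially] E)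
    then show "(\<lambda>k. ?F (real k) - ?F 0) \<longlonglongrightarrow> X"
      by (simp add: mat_exp_zero)
  qed
  then show ?thesis
    unfolding lyapunov_op_def by (simp add: integral_unique)
qed

section \<open>Perturbations and the transfer function\<close>

text \<open>An eigenvector of M + E for an eigenvalue with nonnegative real part satisfies lv - Mv =
  Ev, which contradicts the resolvent bound when \<open>E\<close> is small.\<close>

lemma hurwitz_perturbation:
  fixes M :: "real^'n^'n"
  assumes "hurwitz M"
  obtains e where "e > 0" "\<And>E. norm E < e \<Longrightarrow> hurwitz (M + E)"
proof -
  obtain c where c: "c > 0"
    "\<And>l v. Re l \<ge> 0 \<Longrightarrow> c * norm v \<le> norm (l *s v - complex_mat M *v v)"
    using hurwitz_resolvent_bound[OF assms] by blast
  obtain K1 where K1: "K1 > 0" "\<And>E::real^'n^'n. norm (complex_mat E) \<le> norm E * K1"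
    using bounded_linear.pos_bounded[OF bounded_linear_complex_mat] by blast
  obtain K2 where K2: "K2 > 0" "\<And>(X::complex^'n^'n) (v::complex^'n). norm (X *v v) \<le> norm X * norm v * K2"
    using bounded_bilinear.pos_bounded[OF bounded_bilinear_matrix_vector_mult] by blast
  show thesis
  proof (rule that)
    show "c / (K1 * K2) > 0" using c(1) K1(1) K2(1) by simp
    fix E :: "real^'n^'n" assume E: "norm E < c / (K1 * K2)"
    show "hurwitz (M + E)" unfolding hurwitz_def
    proof (intro allI impI, rule ccontr)
      fix l :: complex and v :: "complex^'n"
      assume v: "v \<noteq> 0" "complex_mat (M + E) *v v = l *s v" and "\<not> Re l < 0"
      then have "c * norm v \<le> norm (l *s v - complex_mat M *v v)"
        using c(2) by simp
      also have "l *s v - complex_mat M *v v = complex_mat E *v v"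
        unfolding v(2)[symmetric] by (simp add: linear_simps[OF bounded_linear_complex_mat]
            matrix_vector_mult_add_rdistrib)
      also have "norm (complex_mat E *v v) \<le> norm (complex_mat E) * norm v * K2" by (rule K2)
      also have "\<dots> \<le> norm E * K1 * norm v * K2"
        using K1(2)[of E] K2(1) by (intro mult_right_mono) auto
      finally have "c * norm v \<le> (norm E * (K1 * K2)) * norm v" by (simp add: mult_ac)
      then have "c \<le> norm E * (K1 * K2)" using v(1) by simp
      then show False using E K1(1) K2(1) by (simp add: field_simps)
    qed
  qed
qed

lemma mat_mult_vec: "mat s *v v = s *s (v :: complex^'n)"
  by (simp add: vec_eq_iff matrix_vector_mult_def mat_def if_distrib[of "\<lambda>x. x * _"] cong: if_cong)

lemma matrix_inv_inverse:
  assumes "invertible X"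
  shows "matrix_inv X ** X = mat 1" "X ** matrix_inv X = mat 1"
  using someI_ex[OF assms[unfolded invertible_def]] unfolding matrix_inv_def by simp_all

text \<open>The lower bound makes the kernel trivial and bounds the inverse. The Lipschitz estimate
  is the resolvent identity R(s) - R(z) = (z - s) R(s) R(z) with both factors bounded.\<close>

lemma hurwitz_resolvent:
  fixes M :: "real^'n^'n"
  assumes "hurwitz M"
  obtains c where "c > 0"
    "\<And>s v. Re s \<ge> 0 \<Longrightarrow> norm (matrix_inv (mat s - complex_mat M) *v v) \<le> c * norm v"
    "\<And>s z v. Re s \<ge> 0 \<Longrightarrow> Re z \<ge> 0 \<Longrightarrow>
      norm (matrix_inv (mat s - complex_mat M) *v v - matrix_inv (mat z - complex_mat M) *v v)
        \<le> c\<^sup>2 * norm (s - z) * norm v"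
proof -
  let ?R = "\<lambda>s. matrix_inv (mat s - complex_mat M)"
  obtain d where d: "d > 0"
    "\<And>l v. Re l \<ge> 0 \<Longrightarrow> d * norm v \<le> norm (l *s v - complex_mat M *v v)"
    using hurwitz_resolvent_bound[OF assms] by blast
  have mult: "(mat s - complex_mat M) *v v = s *s v - complex_mat M *v v" for s v
    by (simp add: matrix_vector_mult_diff_rdistrib mat_mult_vec)
  have inv: "?R s *v ((mat s - complex_mat M) *v v) = v" "(mat s - complex_mat M) *v (?R s *v v) = v"
    if s: "Re s \<ge> 0" for s v
  proof -
    have "v = 0" if "(mat s - complex_mat M) *v v = 0" for v
      using d(1) d(2)[OF s, of v] that by (simp add: mult mult_le_0_iff)
    then have "invertible (mat s - complex_mat M)"
      by (simp add: invertible_left_inverse matrix_left_invertible_ker)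
    then show "?R s *v ((mat s - complex_mat M) *v v) = v" "(mat s - complex_mat M) *v (?R s *v v) = v"
      by (simp_all add: matrix_vector_mul_assoc matrix_inv_inverse)
  qed
  have bound: "norm (?R s *v v) \<le> 1 / d * norm v" if "Re s \<ge> 0" for s v
    using d(2)[OF that, of "?R s *v v"] d(1) inv(2)[OF that, of v]
    by (simp add: mult field_simps)
  show thesis
  proof (rule that[OF _ bound])
    fix s z v assume sz: "Re s \<ge> 0" "Re z \<ge> 0"
    have "?R s *v ((z - s) *s (?R z *v v)) = ?R s *v (z *s (?R z *v v) - s *s (?R z *v v))"
      by (simp add: vector_sub_rdistrib)
    also have "z *s (?R z *v v) - s *s (?R z *v v) = v - (mat s - complex_mat M) *v (?R z *v v)"
      using inv(2)[OF sz(2), of v] by (simp add: mult mat_mult_vec algebra_simps)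
    also have "?R s *v \<dots> = ?R s *v v - ?R z *v v"
      by (simp add: matrix_vector_mult_diff_distrib inv(1)[OF sz(1)])
    finally have "norm (?R s *v v - ?R z *v v) = norm (?R s *v ((z - s) *s (?R z *v v)))"
      by simp
    also have "\<dots> \<le> 1 / d * norm ((z - s) *s (?R z *v v))" by (rule bound[OF sz(1)])
    also have "\<dots> \<le> 1 / d * (norm (z - s) * (1 / d * norm v))"
      unfolding norm_vector_smult using d(1) bound[OF sz(2)] by (intro mult_left_mono) auto
    finally show "norm (?R s *v v - ?R z *v v) \<le> (1 / d)\<^sup>2 * norm (s - z) * norm v"
      by (simp add: power2_eq_square norm_minus_commute mult_ac)
  qed (use d(1) in auto)
qed

text \<open>The uniform bound makes the H-infinity norm finite. The Lipschitz bound makes the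
  operator norm continuous in the frequency, hence measurable, as \<open>esssup_I\<close>
  demands.\<close>

lemma transfer_function_norm_bounds:
  fixes A :: "real^'n^'n" and B :: "real^'m^'n" and C :: "real^'n^'p"
  assumes "hurwitz A"
  defines "F \<equiv> \<lambda>\<omega>. transfer_function A B C (\<i> * complex_of_real \<omega>)"
  obtains b L where "b \<ge> 0" "L \<ge> 0" "\<And>\<omega> x. norm (F \<omega> *v x) \<le> b * norm x"
    "\<And>\<omega> \<eta> x. norm (F \<omega> *v x - F \<eta> *v x) \<le> L * \<bar>\<omega> - \<eta>\<bar> * norm x"
proof -
  let ?B = "complex_mat B" and ?C = "complex_mat C"
  define R where "R = (\<lambda>\<omega>. matrix_inv (mat (\<i> * complex_of_real \<omega>) - complex_mat A))"
  obtain c where c: "c > 0" "\<And>\<omega> v. norm (R \<omega> *v v) \<le> c * norm v"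
    "\<And>\<omega> \<eta> v. norm (R \<omega> *v v - R \<eta> *v v) \<le> c\<^sup>2 * \<bar>\<omega> - \<eta>\<bar> * norm v"
  proof -
    obtain c where c: "c > 0"
      "\<And>s v. Re s \<ge> 0 \<Longrightarrow> norm (matrix_inv (mat s - complex_mat A) *v v) \<le> c * norm v"
      "\<And>s z v. Re s \<ge> 0 \<Longrightarrow> Re z \<ge> 0 \<Longrightarrow>
        norm (matrix_inv (mat s - complex_mat A) *v v - matrix_inv (mat z - complex_mat A) *v v)
          \<le> c\<^sup>2 * norm (s - z) * norm v"
      using hurwitz_resolvent[OF assms(1)] by blast
    have "norm (\<i> * complex_of_real \<omega> - \<i> * complex_of_real \<eta>) = \<bar>\<omega> - \<eta>\<bar>" for \<omega> \<eta>
      by (simp add: right_diff_distrib[symmetric] norm_mult flip: of_real_diff)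
    then show thesis
      using that[of c] c(1) c(2)[of "\<i> * complex_of_real _"]
        c(3)[of "\<i> * complex_of_real _" "\<i> * complex_of_real _"]
      by (simp add: R_def)
  qed
  have F: "F \<omega> *v x = ?C *v (R \<omega> *v (?B *v x))" for \<omega> x
    by (simp add: F_def transfer_function_def R_def matrix_vector_mul_assoc matrix_mul_assoc)
  obtain KB where KB: "KB > 0" "\<And>x. norm (?B *v x) \<le> norm x * KB"
    using bounded_linear.pos_bounded[OF matrix_vector_mul_bounded_linear[of ?B]] by blast
  obtain KC where KC: "KC > 0" "\<And>x. norm (?C *v x) \<le> norm x * KC"
    using bounded_linear.pos_bounded[OF matrix_vector_mul_bounded_linear[of ?C]] by blast
  show thesis
  proof (rule that)
    show "KC * (c * KB) \<ge> 0" "KC * (c\<^sup>2 * KB) \<ge> 0" using KB(1) KC(1) c(1) by auto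
    fix \<omega> \<eta> x
    have "norm (F \<omega> *v x) \<le> norm (R \<omega> *v (?B *v x)) * KC" unfolding F by (rule KC)
    also have "\<dots> \<le> (c * (norm x * KB)) * KC"
      using c(1) KC(1) KB(2)[of x] c(2)[of \<omega> "?B *v x"]
      by (intro mult_right_mono) (auto intro: order_trans mult_left_mono)
    finally show "norm (F \<omega> *v x) \<le> KC * (c * KB) * norm x" by (simp add: mult_ac)
    have "norm (F \<omega> *v x - F \<eta> *v x) \<le> norm (R \<omega> *v (?B *v x) - R \<eta> *v (?B *v x)) * KC"
      unfolding F matrix_vector_mult_diff_distrib[symmetric] by (rule KC)
    also have "\<dots> \<le> (c\<^sup>2 * \<bar>\<omega> - \<eta>\<bar> * (norm x * KB)) * KC"
      using KC(1) by (intro mult_right_mono order_trans[OF c(3)] mult_left_mono KB(2)) auto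
    finally show "norm (F \<omega> *v x - F \<eta> *v x) \<le> KC * (c\<^sup>2 * KB) * \<bar>\<omega> - \<eta>\<bar> * norm x"
      by (simp add: mult_ac)
  qed
qed

lemma hinf_norm_finite:
  fixes A :: "real^'n^'n" and B :: "real^'m^'n" and C :: "real^'n^'p"
  assumes "hurwitz A"
  shows "0 \<le> hinf_norm (transfer_function A B C)" "hinf_norm (transfer_function A B C) < \<infinity>"
proof -
  let ?F = "\<lambda>\<omega>. transfer_function A B C (\<i> * complex_of_real \<omega>)"
  obtain b L where b: "b \<ge> 0" "L \<ge> 0" "\<And>\<omega> x. norm (?F \<omega> *v x) \<le> b * norm x"
    "\<And>\<omega> \<eta> x. norm (?F \<omega> *v x - ?F \<eta> *v x) \<le> L * \<bar>\<omega> - \<eta>\<bar> * norm x"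
    using transfer_function_norm_bounds[OF assms, of B C] by blast
  define f where "f = (\<lambda>\<omega>. onorm (\<lambda>x. ?F \<omega> *v x))"
  have f: "0 \<le> f \<omega>" "f \<omega> \<le> b" for \<omega>
    unfolding f_def using b by (auto intro!: onorm_pos_le onorm_le matrix_vector_mul_bounded_linear)
  have le: "f \<omega> \<le> f \<eta> + L * \<bar>\<omega> - \<eta>\<bar>" for \<omega> \<eta>
    unfolding f_def
  proof (rule onorm_le)
    fix x
    have "norm (?F \<omega> *v x) \<le> norm (?F \<eta> *v x) + norm (?F \<omega> *v x - ?F \<eta> *v x)"
      by (metis add.commute diff_add_cancel norm_triangle_ineq)
    also have "\<dots> \<le> f \<eta> * norm x + L * \<bar>\<omega> - \<eta>\<bar> * norm x"
      unfolding f_def by (intro add_mono onorm b matrix_vector_mul_bounded_linear)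
    finally show "norm (?F \<omega> *v x) \<le> (onorm (\<lambda>x. ?F \<eta> *v x) + L * \<bar>\<omega> - \<eta>\<bar>) * norm x"
      by (simp add: f_def distrib_right)
  qed
  have "L-lipschitz_on UNIV f"
  proof (intro lipschitz_onI b(2))
    fix \<omega> \<eta>
    have "\<bar>f \<omega> - f \<eta>\<bar> \<le> L * \<bar>\<omega> - \<eta>\<bar>"
      using le[of \<omega> \<eta>] le[of \<eta> \<omega>] by (simp add: abs_le_iff abs_minus_commute)
    then show "dist (f \<omega>) (f \<eta>) \<le> L * dist \<omega> \<eta>" by (simp add: dist_real_def)
  qed
  then have "continuous_on UNIV f" by (rule lipschitz_on_continuous_on)
  then have meas: "(\<lambda>\<omega>. ereal (f \<omega>)) \<in> borel_measurable lborel"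
    using borel_measurable_ereal[OF borel_measurable_continuous_onI] by simp
  have hinf: "hinf_norm (transfer_function A B C) = esssup lborel (\<lambda>\<omega>. ereal (f \<omega>))"
    by (simp add: hinf_norm_def f_def)
  have "hinf_norm (transfer_function A B C) \<le> ereal b"
    unfolding hinf using f by (intro esssup_I meas) auto
  then show "hinf_norm (transfer_function A B C) < \<infinity>" by (rule order.strict_trans1) simp
  \<comment> \<open>The zero function has essential supremum 0 because Lebesgue measure is not the
    null measure.\<close>
  have "esssup lborel (\<lambda>\<omega>::real. 0::ereal) \<le> esssup lborel (\<lambda>\<omega>. ereal (f \<omega>))"
    using f by (intro esssup_mono) auto
  then show "0 \<le> hinf_norm (transfer_function A B C)"
    unfolding hinf by (subst (asm) esssup_const) auto
qed

lemma hinf_norm_bound_pos: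
  fixes A :: "real^'n^'n" and B :: "real^'m^'n" and C :: "real^'n^'p"
  assumes "hurwitz A"
  obtains e where "e > 0" "\<And>\<theta>. \<bar>\<theta>\<bar> < e \<Longrightarrow> ereal \<theta> < inverse ((hinf_norm (transfer_function A B C))\<^sup>2)"
proof -
  let ?h = "hinf_norm (transfer_function A B C)"
  obtain r where r: "?h = ereal r" "r \<ge> 0"
    using hinf_norm_finite[OF assms, of B C] by (cases ?h) auto
  \<comment> \<open>The case \<open>r = 0\<close> uses the convention
    \<open>inverse 0 = \<infinity>\<close> in \<open>ereal\<close>.\<close>
  have "0 < inverse (?h\<^sup>2)"
    using r(2) by (cases "r = 0") (auto simp: r(1) power2_eq_square)
  then obtain e where "0 < ereal e" "ereal e < inverse (?h\<^sup>2)"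
    using ereal_dense2 by blast
  then show thesis
    by (intro that[of e]) (auto elim: less_trans[rotated] simp: abs_less_iff)
qed

section \<open>Differentiability of solutions of Sylvester equations\<close>

text \<open>Dividing by \<open>s - t\<close> instead of its absolute value changes only a sign,
  which the norm does not see.\<close>

lemma has_vector_derivative_iff_difference_quotient:
  "(f has_vector_derivative D) (at t) \<longleftrightarrow>
    ((\<lambda>s. (1 / (s - t)) *\<^sub>R (f s - f t)) \<longlongrightarrow> D) (at t)"
proof -
  have "norm ((1 / norm (s - t)) *\<^sub>R (f s - (f t + (s - t) *\<^sub>R D))) =
      norm ((1 / (s - t)) *\<^sub>R (f s - f t) - D)" if "s \<noteq> t" for s
  proof -
    have "(1 / (s - t)) *\<^sub>R (f s - f t) - D = (1 / (s - t)) *\<^sub>R (f s - (f t + (s - t) *\<^sub>R D))"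
      using that by (simp add: scaleR_diff_right scaleR_add_right)
    then show ?thesis by simp
  qed
  then have "((\<lambda>s. norm ((1 / norm (s - t)) *\<^sub>R (f s - (f t + (s - t) *\<^sub>R D)))) \<longlongrightarrow> 0) (at t)
      \<longleftrightarrow> ((\<lambda>s. norm ((1 / (s - t)) *\<^sub>R (f s - f t) - D)) \<longlongrightarrow> 0) (at t)"
    by (intro tendsto_cong) (auto simp: eventually_at_filter)
  then show ?thesis
    unfolding has_vector_derivative_def has_derivative_at2
    by (simp only: tendsto_norm_zero_iff LIM_zero_iff bounded_linear_scaleR_left simp_thms)
qed

text \<open>An injective linear map has a linear left inverse, which is bounded in finite dimension;
  thus \<open>X\<close> is controlled by \<open>P ** X + X ** Q\<close>.\<close>

lemma sylvester_left_inverse: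
  fixes P Q :: "real^'n^'n"
  assumes "\<And>X :: real^'n^'n. P ** X + X ** Q = 0 \<Longrightarrow> X = 0"
  obtains S where "bounded_linear S" "\<And>X. S (P ** X + X ** Q) = X"
proof -
  let ?T = "\<lambda>X. P ** X + X ** Q"
  have "bounded_linear ?T"
    by (intro bounded_linear_add bounded_bilinear.bounded_linear_left[OF bounded_bilinear_matrix_mult]
        bounded_bilinear.bounded_linear_right[OF bounded_bilinear_matrix_mult])
  then have "linear ?T" by (simp add: linear_conv_bounded_linear)
  moreover have "inj ?T"
    unfolding linear_injective_0[OF \<open>linear ?T\<close>] using assms by blast
  ultimately obtain S where "linear S" "S \<circ> ?T = id"
    using linear_injective_left_inverse by blast
  then show thesis
    by (intro that[of S]) (auto simp: linear_conv_bounded_linear fun_eq_iff)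
qed

text \<open>Continuity of the coefficients suffices because \<open>h t = 0\<close>; this is what yields the first
  derivative of a merely continuous solution of the Riccati equation.\<close>

lemma sylvester_differentiable_at_zero:
  fixes P Q Y h :: "real \<Rightarrow> real^'n^'n"
  assumes P: "isCont P t" and Q: "isCont Q t"
    and eq: "\<forall>\<^sub>F s in nhds t. P s ** Y s + Y s ** Q s = h s"
    and h: "(h has_vector_derivative h') (at t)" "h t = 0"
    and inj: "\<And>X :: real^'n^'n. P t ** X + X ** Q t = 0 \<Longrightarrow> X = 0"
  shows "\<exists>D. (Y has_vector_derivative D) (at t)"
proof -
  obtain S where S: "bounded_linear S" "\<And>X. S (P t ** X + X ** Q t) = X"
    using sylvester_left_inverse[of "P t" "Q t"] inj by metis
  obtain b where b: "b > 0" "\<And>X. norm (S X) \<le> norm X * b"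
    using bounded_linear.pos_bounded[OF S(1)] by blast
  obtain K where K: "K > 0" "\<And>(X::real^'n^'n) (Y::real^'n^'n). norm (X ** Y) \<le> norm X * norm Y * K"
    using bounded_bilinear.pos_bounded[OF bounded_bilinear_matrix_mult] by blast
  have "P t ** Y t + Y t ** Q t = 0"
    using eventually_nhds_x_imp_x[OF eq] h(2) by simp
  then have Yt: "Y t = 0" by (rule inj)
  define Z where "Z = (\<lambda>s. (1 / (s - t)) *\<^sub>R Y s)"
  define k where "k = (\<lambda>s. (1 / (s - t)) *\<^sub>R h s)"
  \<comment> \<open>\<open>Z\<close> is the difference quotient of \<open>Y\<close>. Freezing the
    coefficients at \<open>t\<close> turns its equation into one with constant coefficients and
    error \<open>E\<close>.\<close>
  define E where "E = (\<lambda>s. (P s - P t) ** Z s + Z s ** (Q s - Q t))"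
  define \<eta> where "\<eta> = (\<lambda>s. (norm (P s - P t) + norm (Q s - Q t)) * K)"
  have k: "(k \<longlongrightarrow> h') (at t)"
    using h by (simp add: has_vector_derivative_iff_difference_quotient k_def)
  have \<eta>: "(\<eta> \<longlongrightarrow> 0) (at t)"
  proof -
    have "(\<eta> \<longlongrightarrow> (norm (P t - P t) + norm (Q t - Q t)) * K) (at t)"
      unfolding \<eta>_def using P Q by (intro tendsto_intros) (auto simp: isCont_def)
    then show ?thesis by simp
  qed
  have E: "norm (E s) \<le> \<eta> s * norm (Z s)" for s
  proof -
    have "norm (E s) \<le> norm (P s - P t) * norm (Z s) * K + norm (Z s) * norm (Q s - Q t) * K"
      unfolding E_def by (intro norm_triangle_le add_mono K(2))
    then show ?thesis by (simp add: \<eta>_def algebra_simps)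
  qed
  have TZ: "\<forall>\<^sub>F s in at t. P t ** Z s + Z s ** Q t = k s - E s"
    using eventually_nhds_conv_at[THEN iffD1, OF eq, THEN conjunct1]
  proof eventually_elim
    case (elim s)
    have "k s = P s ** Z s + Z s ** Q s"
      unfolding k_def elim[symmetric] Z_def
      by (simp add: scaleR_add_right bounded_bilinear.scaleR_left[OF bounded_bilinear_matrix_mult]
          bounded_bilinear.scaleR_right[OF bounded_bilinear_matrix_mult])
    then show ?case
      by (simp add: E_def bounded_bilinear.diff_left[OF bounded_bilinear_matrix_mult]
          bounded_bilinear.diff_right[OF bounded_bilinear_matrix_mult])
  qed
  \<comment> \<open>Below \<open>1 / (2 * b)\<close> the error is at most half of
    \<open>norm (Z s)\<close> after applying \<open>S\<close>, so it can be absorbed. This bounds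
    \<open>Z\<close> by \<open>k\<close> and then forces \<open>E\<close> to 0.\<close>
  have "\<forall>\<^sub>F s in at t. \<eta> s < 1 / (2 * b)"
    using order_tendstoD(2)[OF \<eta>, of "1 / (2 * b)"] b(1) by simp
  with TZ have Zk: "\<forall>\<^sub>F s in at t. norm (E s) \<le> \<eta> s * (2 * b * norm (k s))"
  proof eventually_elim
    case (elim s)
    have "norm (Z s) = norm (S (k s - E s))" using S(2)[of "Z s"] elim(1) by simp
    also have "\<dots> \<le> norm (k s - E s) * b" by (rule b(2))
    also have "\<dots> \<le> (norm (k s) + \<eta> s * norm (Z s)) * b"
      using norm_triangle_ineq4[of "k s" "E s"] E[of s] b(1) by (intro mult_right_mono) auto
    finally have "norm (Z s) \<le> norm (k s) * b + (\<eta> s * b) * norm (Z s)"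
      by (simp add: algebra_simps)
    moreover have "(\<eta> s * b) * norm (Z s) \<le> 1 / 2 * norm (Z s)"
      using elim(2) b(1) by (intro mult_right_mono) (auto simp: field_simps)
    ultimately have "norm (Z s) \<le> 2 * b * norm (k s)" by (simp add: mult_ac)
    moreover have "\<eta> s \<ge> 0" using K(1) by (simp add: \<eta>_def)
    ultimately show ?case by (intro order_trans[OF E] mult_left_mono)
  qed
  have "((\<lambda>s. \<eta> s * (2 * b * norm (k s))) \<longlongrightarrow> 0 * (2 * b * norm h')) (at t)"
    by (intro tendsto_intros \<eta> k)
  then have "(E \<longlongrightarrow> 0) (at t)"
    using Zk by (intro Lim_null_comparison[OF Zk]) simp
  then have "((\<lambda>s. S (k s - E s)) \<longlongrightarrow> S (h' - 0)) (at t)"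
    by (intro bounded_linear.tendsto[OF S(1)] tendsto_diff k)
  moreover have "\<forall>\<^sub>F s in at t. S (k s - E s) = Z s"
    using TZ
  proof eventually_elim
    case (elim s)
    show ?case unfolding elim[symmetric] by (rule S(2))
  qed
  ultimately have "(Z \<longlongrightarrow> S h') (at t)"
    by (simp add: tendsto_cong)
  then have "(Y has_vector_derivative S h') (at t)"
    by (simp add: has_vector_derivative_iff_difference_quotient Z_def Yt)
  then show ?thesis by blast
qed

text \<open>Subtracting the constant \<open>Y t\<close> leaves a Sylvester equation whose right-hand
  side is differentiable and vanishes at \<open>t\<close>, the situation of the preceding
  lemma.\<close>

lemma sylvester_differentiable:
  fixes P Q Y R :: "real \<Rightarrow> real^'n^'n"
  assumes P: "(P has_vector_derivative P') (at t)" and Q: "(Q has_vector_derivative Q') (at t)"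
    and R: "(R has_vector_derivative R') (at t)"
    and eq: "\<forall>\<^sub>F s in nhds t. P s ** Y s + Y s ** Q s = R s"
    and inj: "\<And>X :: real^'n^'n. P t ** X + X ** Q t = 0 \<Longrightarrow> X = 0"
  shows "\<exists>D. (Y has_vector_derivative D) (at t)"
proof -
  let ?h = "\<lambda>s. R s - (P s ** Y t + Y t ** Q s)"
  have "(?h has_vector_derivative R' - (P' ** Y t + Y t ** Q')) (at t)"
    by (intro has_vector_derivative_diff has_vector_derivative_add R
        bounded_linear.has_vector_derivative[OF bounded_bilinear.bounded_linear_left[OF
            bounded_bilinear_matrix_mult] P]
        bounded_linear.has_vector_derivative[OF bounded_bilinear.bounded_linear_right[OF
            bounded_bilinear_matrix_mult] Q])
  note h = this
  have e: "\<forall>\<^sub>F s in nhds t. P s ** (Y s - Y t) + (Y s - Y t) ** Q s = ?h s"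
    using eq by eventually_elim
      (simp add: bounded_bilinear.diff_left[OF bounded_bilinear_matrix_mult]
          bounded_bilinear.diff_right[OF bounded_bilinear_matrix_mult] algebra_simps)
  have h0: "?h t = 0"
    using eventually_nhds_x_imp_x[OF eq] by simp
  have "\<exists>D. ((\<lambda>s. Y s - Y t) has_vector_derivative D) (at t)"
    by (rule sylvester_differentiable_at_zero[OF has_vector_derivative_continuous[OF P]
        has_vector_derivative_continuous[OF Q] e h h0]) (rule inj)
  then obtain D where "((\<lambda>s. Y s - Y t) has_vector_derivative D) (at t)" ..
  then have "((\<lambda>s. (Y s - Y t) + Y t) has_vector_derivative D) (at t)"
    by (simp only: has_vector_derivative_add_const)
  then show ?thesis by auto
qed

section \<open>Local solutions of the Riccati equation\<close>

text \<open>With the parameter term moved to the other side, solving the Riccati equation means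
  inverting one fixed quadratic map along the line of matrices -\<theta>\<Omega>.\<close>

definition riccati :: "real^'n^'n \<Rightarrow> real^'n^'n \<Rightarrow> real^'n^'n \<Rightarrow> real^'n^'n" where
  "riccati A U X = transpose A ** X + X ** A + X ** U ** X"

text \<open>The quadratic part splits as XUX - YUY = XU(X - Y) + (X - Y)UY.\<close>

lemma riccati_diff:
  "riccati A U X - riccati A U Y =
    (transpose A + X ** U) ** (X - Y) + (X - Y) ** (A + U ** Y)"
  by (simp add: riccati_def bounded_bilinear.diff_left[OF bounded_bilinear_matrix_mult]
      bounded_bilinear.diff_right[OF bounded_bilinear_matrix_mult]
      bounded_bilinear.add_left[OF bounded_bilinear_matrix_mult]
      bounded_bilinear.add_right[OF bounded_bilinear_matrix_mult] matrix_mul_assoc algebra_simps)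

text \<open>The derivative of the quadratic map at 0 is H -> A^T H + HA, which is injective because
  \<open>A\<close> is Hurwitz. The inverse function theorem supplies the branch.\<close>

lemma riccati_local_inverse:
  fixes A U :: "real^'n^'n"
  assumes "hurwitz A"
  obtains V \<Phi> where "open V" "0 \<in> V" "continuous_on V \<Phi>" "\<Phi> 0 = 0"
    "\<And>Y. Y \<in> V \<Longrightarrow> riccati A U (\<Phi> Y) = Y"
proof -
  let ?L = "\<lambda>X H. transpose A ** H + H ** A + (H ** U ** X + X ** U ** H)"
  define f' where "f' = (\<lambda>X. Blinfun (?L X))"
  have bl: "bounded_linear (?L X)" for X
    by (intro bounded_linear_add bounded_bilinear.bounded_linear_left[OF bounded_bilinear_matrix_mult]
        bounded_bilinear.bounded_linear_right[OF bounded_bilinear_matrix_mult]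
        bounded_linear_compose[OF bounded_bilinear.bounded_linear_left[OF bounded_bilinear_matrix_mult]
          bounded_bilinear.bounded_linear_left[OF bounded_bilinear_matrix_mult]])
  then have f': "blinfun_apply (f' X) = ?L X" for X
    by (simp add: f'_def bounded_linear_Blinfun_apply)
  have der: "(riccati A U has_derivative blinfun_apply (f' X)) (at X)" for X
    unfolding riccati_def[abs_def] f'
    by (intro has_derivative_add bounded_linear_imp_has_derivative
        bounded_bilinear.bounded_linear_left[OF bounded_bilinear_matrix_mult]
        bounded_bilinear.bounded_linear_right[OF bounded_bilinear_matrix_mult])
      (rule has_derivative_eq_rhs[OF bounded_bilinear.FDERIV[OF bounded_bilinear_matrix_mult
          bounded_linear_imp_has_derivative[OF bounded_bilinear.bounded_linear_left[OF bounded_bilinear_matrix_mult]]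
          has_derivative_ident]], auto simp: add.commute)
  have cont: "continuous_on UNIV f'"
    unfolding f' 
    by (intro continuous_on_blinfun_componentwise)
      (auto simp: f' intro!: continuous_intros bounded_bilinear.continuous_on[OF bounded_bilinear_matrix_mult])
  obtain S where S: "bounded_linear S" "\<And>X. S (transpose A ** X + X ** A) = X"
    using sylvester_left_inverse[of "transpose A" A] hurwitz_sylvester_unique[OF assms assms] by metis
  have "Blinfun S o\<^sub>L f' 0 = id_blinfun"
    by (rule blinfun_eqI) (simp add: f' bounded_linear_Blinfun_apply S
        bounded_bilinear.zero_left[OF bounded_bilinear_matrix_mult]
        bounded_bilinear.zero_right[OF bounded_bilinear_matrix_mult])
  from inverse_function_theorem[OF open_UNIV der cont UNIV_I this]
  obtain U' V g where g: "open V" "riccati A U 0 \<in> V" "0 \<in> U'" "homeomorphism U' V (riccati A U) g"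
    by metis
  have r0: "riccati A U 0 = 0"
    by (simp add: riccati_def bounded_bilinear.zero_left[OF bounded_bilinear_matrix_mult]
        bounded_bilinear.zero_right[OF bounded_bilinear_matrix_mult])
  show thesis
  proof (rule that[of V g])
    show "open V" "0 \<in> V" using g r0 by auto
    show "continuous_on V g" using g(4) by (simp add: homeomorphism_def)
    show "g 0 = 0" using homeomorphism_apply1[OF g(4,3)] r0 by simp
    show "riccati A U (g Y) = Y" if "Y \<in> V" for Y using homeomorphism_apply2[OF g(4) that] .
  qed
qed

text \<open>The transpose makes the lemma applicable to the branch \<open>X\<close> given by the inverse function theorem,
  whose symmetry is not known a priori.\<close>

lemma riccati_unique:
  fixes A U X Y :: "real^'n^'n"
  assumes "transpose U = U" "hurwitz (A + U ** transpose X)" "hurwitz (A + U ** Y)"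
    and "riccati A U X = riccati A U Y"
  shows "X = Y"
proof -
  have "transpose (A + U ** transpose X) = transpose A + X ** U"
    using assms(1) by (simp add: linear_simps[OF bounded_linear_transpose] matrix_transpose_mul)
  then have "transpose (A + U ** transpose X) ** (X - Y) + (X - Y) ** (A + U ** Y) = 0"
    using riccati_diff[of A U X Y] assms(4) by simp
  from hurwitz_sylvester_unique[OF assms(2,3) this] show ?thesis by simp
qed

lemma stabilising_solution_riccati:
  assumes "stabilising_solution A B C \<theta> X"
  shows "riccati A (B ** transpose B) X = - (\<theta> *\<^sub>R (transpose C ** C))"
  using assms unfolding stabilising_solution_def riccati_def
  by (simp add: eq_neg_iff_add_eq_0 algebra_simps)

text \<open>Near 0 the branch from the inverse function theorem is small, so its closed-loop matrix
  is a small perturbation of \<open>A\<close> and stays Hurwitz. Uniqueness identifies it with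
  \<open>\<Psi>\<close>, which inherits continuity and the value at 0.\<close>

lemma stabilising_solution_continuous:
  fixes A :: "real^'n^'n" and B :: "real^'m^'n" and C :: "real^'n^'p"
  assumes A: "hurwitz A" and e: "e > 0"
    and stab: "\<And>\<theta>. \<bar>\<theta>\<bar> < e \<Longrightarrow> stabilising_solution A B C \<theta> (\<Psi> \<theta>)"
  obtains d where "0 < d" "d \<le> e" "\<Psi> 0 = 0" "\<And>\<theta>. \<bar>\<theta>\<bar> < d \<Longrightarrow> isCont \<Psi> \<theta>"
proof -
  let ?U = "B ** transpose B" and ?\<Omega> = "transpose C ** C"
  obtain V \<Phi> where V: "open V" "0 \<in> V" "continuous_on V \<Phi>" "\<Phi> 0 = 0"
    "\<And>Y. Y \<in> V \<Longrightarrow> riccati A ?U (\<Phi> Y) = Y"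
    using riccati_local_inverse[OF A, of ?U] by blast
  obtain r where r: "r > 0" "\<And>E. norm E < r \<Longrightarrow> hurwitz (A + E)"
    using hurwitz_perturbation[OF A] by blast
  define \<phi> where "\<phi> = (\<lambda>\<theta>. \<Phi> (- (\<theta> *\<^sub>R ?\<Omega>)))"
  define S where "S = (\<lambda>\<theta>. - (\<theta> *\<^sub>R ?\<Omega>)) -` V"
  have "open S"
    unfolding S_def by (intro open_vimage V(1) continuous_intros)
  have "0 \<in> S" using V(2) by (simp add: S_def)
  have cont: "continuous_on S \<phi>"
    unfolding \<phi>_def by (rule continuous_on_compose2[OF V(3)]) (auto simp: S_def intro!: continuous_intros)
  have "\<phi> 0 = 0" using V(4) by (simp add: \<phi>_def)
  moreover have "isCont \<phi> 0"
    using cont continuous_on_eq_continuous_at[OF \<open>open S\<close>] \<open>0 \<in> S\<close> by blast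
  ultimately have cont0: "(\<phi> \<longlongrightarrow> 0) (at 0)" by (simp add: isCont_def)
  have "((\<lambda>\<theta>. norm (?U ** transpose (\<phi> \<theta>))) \<longlongrightarrow> norm (?U ** transpose (0 :: real^'n^'n))) (at 0)"
    by (intro tendsto_norm tendsto_matrix_mult tendsto_const
        bounded_linear.tendsto[OF bounded_linear_transpose cont0])
  then have "((\<lambda>\<theta>. norm (?U ** transpose (\<phi> \<theta>))) \<longlongrightarrow> 0) (at 0)"
    by (simp add: linear_simps[OF bounded_linear_transpose]
        bounded_bilinear.zero_right[OF bounded_bilinear_matrix_mult])
  then have "\<forall>\<^sub>F \<theta> in at 0. norm (?U ** transpose (\<phi> \<theta>)) < r"
    using r(1) by (rule order_tendstoD)
  \<comment> \<open>The limit speaks only of a punctured neighbourhood; the value at 0 completes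
    it.\<close>
  moreover have "norm (?U ** transpose (\<phi> 0)) < r"
    using r(1) V(4) by (simp add: \<phi>_def linear_simps[OF bounded_linear_transpose]
        bounded_bilinear.zero_right[OF bounded_bilinear_matrix_mult])
  ultimately have "\<forall>\<^sub>F \<theta> in nhds 0. norm (?U ** transpose (\<phi> \<theta>)) < r"
    by (simp add: eventually_nhds_conv_at)
  moreover have "\<forall>\<^sub>F \<theta> in nhds 0. \<theta> \<in> S"
    using \<open>open S\<close> \<open>0 \<in> S\<close> by (rule eventually_nhds_in_open)
  moreover have "\<forall>\<^sub>F \<theta> in nhds 0. \<bar>\<theta>\<bar> < e"
    using eventually_nhds_in_open[of "ball 0 e" "0 :: real"] e by (simp add: dist_real_def)
  ultimately have "\<forall>\<^sub>F \<theta> in nhds 0. \<theta> \<in> S \<and> \<bar>\<theta>\<bar> < e \<and> norm (?U ** transpose (\<phi> \<theta>)) < r"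
    by eventually_elim simp
  then obtain d where d: "d > 0"
    "\<And>\<theta>. \<bar>\<theta>\<bar> < d \<Longrightarrow> \<theta> \<in> S \<and> \<bar>\<theta>\<bar> < e \<and> norm (?U ** transpose (\<phi> \<theta>)) < r"
    by (auto simp: eventually_nhds_metric dist_real_def)
  have eq: "\<Psi> \<theta> = \<phi> \<theta>" if "\<bar>\<theta>\<bar> < d" for \<theta>
  proof (rule riccati_unique[symmetric])
    show "transpose ?U = ?U" by (simp add: matrix_transpose_mul)
    show "hurwitz (A + ?U ** transpose (\<phi> \<theta>))" using d(2)[OF that] by (intro r(2)) simp
    have st: "stabilising_solution A B C \<theta> (\<Psi> \<theta>)" using d(2)[OF that] stab by simp
    then show "hurwitz (A + ?U ** \<Psi> \<theta>)" by (simp add: stabilising_solution_def)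
    show "riccati A ?U (\<phi> \<theta>) = riccati A ?U (\<Psi> \<theta>)"
      using d(2)[OF that] stabilising_solution_riccati[OF st] by (simp add: \<phi>_def V(5) S_def)
  qed
  show thesis
  proof (rule that[of "min d e"])
    show "0 < min d e" "min d e \<le> e" using d(1) e by auto
    show "\<Psi> 0 = 0" using eq[of 0] d(1) V(4) by (simp add: \<phi>_def)
    fix \<theta> assume \<theta>: "\<bar>\<theta>\<bar> < min d e"
    have "continuous_on (ball 0 d) \<phi>"
      by (rule continuous_on_subset[OF cont]) (use d(2) in \<open>auto simp: dist_real_def\<close>)
    then have "continuous_on (ball 0 d) \<Psi>"
      by (subst continuous_on_cong[OF refl eq]) (auto simp: dist_real_def)
    then show "isCont \<Psi> \<theta>"
      using \<theta> by (simp add: continuous_on_eq_continuous_at dist_real_def)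
  qed
qed

section \<open>Differentiating the Riccati equation\<close>

lemma nth_vderiv_0: "nth_vderiv 0 f = f"
  by (simp add: nth_vderiv_def)

lemma nth_vderiv_Suc: "nth_vderiv (Suc k) f t = vector_derivative (nth_vderiv k f) (at t)"
  by (simp add: nth_vderiv_def)

text \<open>\<open>vector_derivative\<close> is defined by choice, so existence has to be shown
  before its value is a derivative.\<close>

lemma nth_vderiv_has_vector_derivative:
  assumes "\<exists>D. (nth_vderiv k f has_vector_derivative D) (at t)"
  shows "(nth_vderiv k f has_vector_derivative nth_vderiv (Suc k) f t) (at t)"
  using assms unfolding nth_vderiv_Suc
  by (metis vector_derivative_works differentiableI_vector)

text \<open>In the Leibniz sum of order \<open>n\<close> only the two end terms contain the
  derivative of order \<open>n\<close>; they join the linear part of the equation.\<close>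

lemma sum_atMost_ends:
  fixes f :: "nat \<Rightarrow> 'a::comm_monoid_add"
  assumes "n \<ge> 1"
  shows "sum f {..n} = f 0 + f n + sum f {1..<n}"
proof -
  have "{..n} = insert 0 (insert n {1..<n})" using assms by auto
  then show ?thesis using assms by (simp add: add.assoc)
qed

text \<open>Pascal's rule, where \<open>p j i\<close> stands for a product of derivatives of orders
  \<open>j\<close> and \<open>i\<close>. This is the inductive step of the Leibniz rule.\<close>

lemma binomial_leibniz_sum:
  fixes p :: "nat \<Rightarrow> nat \<Rightarrow> 'a::real_vector"
  shows "(\<Sum>j\<le>k. real (k choose j) *\<^sub>R (p j (Suc (k - j)) + p (Suc j) (k - j)))
    = (\<Sum>j\<le>Suc k. real (Suc k choose j) *\<^sub>R p j (Suc k - j))"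
proof -
  have "(\<Sum>j\<le>Suc k. real (Suc k choose j) *\<^sub>R p j (Suc k - j))
      = p 0 (Suc k) + (\<Sum>j\<le>k. real (Suc k choose Suc j) *\<^sub>R p (Suc j) (k - j))"
    by (simp only: sum.atMost_Suc_shift) simp
  also have "\<dots> = (p 0 (Suc k) + (\<Sum>j\<le>k. real (k choose Suc j) *\<^sub>R p (Suc j) (k - j)))
      + (\<Sum>j\<le>k. real (k choose j) *\<^sub>R p (Suc j) (k - j))"
    by (simp add: sum.distrib scaleR_add_left add.commute add.left_commute)
  also have "p 0 (Suc k) + (\<Sum>j\<le>k. real (k choose Suc j) *\<^sub>R p (Suc j) (k - j))
      = (\<Sum>j\<le>Suc k. real (k choose j) *\<^sub>R p j (Suc k - j))"
    by (simp only: sum.atMost_Suc_shift) simp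
  \<comment> \<open>The term \<open>j = Suc k\<close> drops out since \<open>k choose Suc k\<close>
    is 0.\<close>
  also have "\<dots> = (\<Sum>j\<le>k. real (k choose j) *\<^sub>R p j (Suc (k - j)))"
    by (simp add: Suc_diff_le)
  finally show ?thesis by (simp add: sum.distrib scaleR_add_right)
qed

text \<open>Equation and differentiability are proved in one induction: differentiability up to
  order \<open>k\<close> permits differentiating equation \<open>k\<close>, and the resulting
  equation makes the next derivative differentiable. \<open>r k\<close> is the \<open>k\<close>-th
  derivative of t\<Omega>.\<close>

lemma nth_vderiv_riccati_family:
  fixes A U \<Omega> :: "real^'n^'n"
  assumes S: "open S" and U: "transpose U = U"
    and sym: "\<And>t. t \<in> S \<Longrightarrow> transpose (\<Psi> t) = \<Psi> t"
    and eq: "\<And>t. t \<in> S \<Longrightarrow> riccati A U (\<Psi> t) = - (t *\<^sub>R \<Omega>)"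
    and hur: "\<And>t. t \<in> S \<Longrightarrow> hurwitz (A + U ** \<Psi> t)"
    and cont: "\<And>t. t \<in> S \<Longrightarrow> isCont \<Psi> t"
  defines "D \<equiv> \<lambda>k. nth_vderiv k \<Psi>"
    and "r \<equiv> \<lambda>k t. if k = 0 then t *\<^sub>R \<Omega> else if k = 1 then \<Omega> else 0"
  shows "(\<forall>t\<in>S. transpose A ** D k t + D k t ** A + r k t
        + (\<Sum>j\<le>k. real (k choose j) *\<^sub>R (D j t ** U ** D (k - j) t)) = 0)
    \<and> (\<forall>j\<le>k. \<forall>t\<in>S. (D j has_vector_derivative D (Suc j) t) (at t))"
proof (induction k)
  \<comment> \<open>The left coefficient is the transpose of the right one, by symmetry of
    \<open>\<Psi> t\<close>, so both exponentials decay.\<close>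
  have inj: "X = 0" if "t \<in> S" "(transpose A + \<Psi> t ** U) ** X + X ** (A + U ** \<Psi> t) = 0" for t X
  proof -
    have "transpose (A + U ** \<Psi> t) = transpose A + \<Psi> t ** U"
      using that(1) by (simp add: linear_simps[OF bounded_linear_transpose] matrix_transpose_mul U sym)
    then show ?thesis using hurwitz_sylvester_unique[OF hur[OF that(1)] hur[OF that(1)]] that(2) by metis
  qed
  {
    case 0
    have "\<exists>D. (\<Psi> has_vector_derivative D) (at t)" if t: "t \<in> S" for t
    proof -
      \<comment> \<open>In \<open>riccati_diff\<close> the right coefficient is constant in
        \<open>s\<close> and the left one is merely continuous, which is all that is known of
        \<open>\<Psi>\<close> so far.\<close>
      have ev: "\<forall>\<^sub>F s in nhds t. (transpose A + \<Psi> s ** U) ** (\<Psi> s - \<Psi> t)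
          + (\<Psi> s - \<Psi> t) ** (A + U ** \<Psi> t) = (t - s) *\<^sub>R \<Omega>"
        using eventually_nhds_in_open[OF S t]
        by eventually_elim (simp add: riccati_diff[symmetric] eq t scaleR_diff_left)
      have h': "((\<lambda>s. (t - s) *\<^sub>R \<Omega>) has_vector_derivative - \<Omega>) (at t)"
        by (auto intro!: derivative_eq_intros)
      have "isCont (\<lambda>s. transpose A + \<Psi> s ** U) t"
        using cont[OF t] unfolding isCont_def
        by (intro tendsto_add tendsto_const tendsto_matrix_mult)
      from sylvester_differentiable_at_zero[OF this _ ev h', OF _ _ inj[OF t]]
      have "\<exists>D. ((\<lambda>s. \<Psi> s - \<Psi> t) has_vector_derivative D) (at t)" by simp
      then obtain D where "((\<lambda>s. \<Psi> s - \<Psi> t + \<Psi> t) has_vector_derivative D) (at t)"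
        by (auto simp only: has_vector_derivative_add_const)
      then show ?thesis by auto
    qed
    then have "(\<Psi> has_vector_derivative D 1 t) (at t)" if "t \<in> S" for t
      using that nth_vderiv_has_vector_derivative[of 0 \<Psi> t] by (simp add: D_def nth_vderiv_0)
    moreover have "transpose A ** \<Psi> t + \<Psi> t ** A + t *\<^sub>R \<Omega> + \<Psi> t ** U ** \<Psi> t = 0" if "t \<in> S" for t
      using eq[OF that] by (simp add: riccati_def eq_neg_iff_add_eq_0 algebra_simps)
    ultimately show ?case by (simp add: D_def r_def nth_vderiv_0)
  next
    case (Suc k)
    have der: "(D j has_vector_derivative D (Suc j) t) (at t)" if "j \<le> k" "t \<in> S" for j t
      using Suc that by blast
    have prod: "((\<lambda>t. D j t ** U ** D i t) has_vector_derivative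
        D j t ** U ** D (Suc i) t + D (Suc j) t ** U ** D i t) (at t)"
      if "j \<le> k" "i \<le> k" "t \<in> S" for i j t
      by (rule has_vector_derivative_matrix_mult[OF bounded_linear.has_vector_derivative[OF
            bounded_bilinear.bounded_linear_left[OF bounded_bilinear_matrix_mult] der[OF that(1,3)]]
            der[OF that(2,3)]])
    let ?G = "\<lambda>k t. transpose A ** D k t + D k t ** A + r k t
        + (\<Sum>j\<le>k. real (k choose j) *\<^sub>R (D j t ** U ** D (k - j) t))"
    have G: "?G (Suc k) t = 0" if t: "t \<in> S" for t
    proof -
      have r': "(r k has_vector_derivative r (Suc k) t) (at t)"
        unfolding r_def by (auto intro!: derivative_eq_intros)
      have "(?G k has_vector_derivative
          (transpose A ** D (Suc k) t + D (Suc k) t ** A + r (Suc k) t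
          + (\<Sum>j\<le>k. real (k choose j) *\<^sub>R (D j t ** U ** D (Suc (k - j)) t + D (Suc j) t ** U ** D (k - j) t)))) (at t)"
        using t by (intro has_vector_derivative_add r' has_vector_derivative_sum
            bounded_linear.has_vector_derivative[OF bounded_bilinear.bounded_linear_left[OF
                bounded_bilinear_matrix_mult]]
            bounded_linear.has_vector_derivative[OF bounded_bilinear.bounded_linear_right[OF
                bounded_bilinear_matrix_mult]]
            bounded_linear.has_vector_derivative[OF bounded_linear_scaleR_right] prod der) auto
      also have "(\<Sum>j\<le>k. real (k choose j) *\<^sub>R (D j t ** U ** D (Suc (k - j)) t + D (Suc j) t ** U ** D (k - j) t))
          = (\<Sum>j\<le>Suc k. real (Suc k choose j) *\<^sub>R (D j t ** U ** D (Suc k - j) t))"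
        by (rule binomial_leibniz_sum[of k "\<lambda>j i. D j t ** U ** D i t"])
      finally have "(?G k has_vector_derivative ?G (Suc k) t) (at t)" .
      \<comment> \<open>By the induction hypothesis \<open>?G k\<close> vanishes on the open set
        \<open>S\<close>, so its derivative is also 0.\<close>
      moreover have "(?G k has_vector_derivative 0) (at t)"
        using Suc by (intro has_vector_derivative_transform_within_open[OF has_vector_derivative_const S t]) simp
      ultimately show ?thesis by (rule vector_derivative_unique_at)
    qed
    have "\<exists>X. (D (Suc k) has_vector_derivative X) (at t)" if t: "t \<in> S" for t
    proof -
      \<comment> \<open>The sum retains the indices 1 to \<open>k\<close>, so only derivatives of
        order at most \<open>k\<close> occur and \<open>?R\<close> is differentiable by the
        induction hypothesis. The end terms of the full sum supply the coefficients with
        \<open>\<Psi>\<close>.\<close>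
      let ?R = "\<lambda>t. - (r (Suc k) t + (\<Sum>j\<in>{1..<Suc k}. real (Suc k choose j) *\<^sub>R (D j t ** U ** D (Suc k - j) t)))"
      have \<Psi>': "(\<Psi> has_vector_derivative D 1 t) (at t)"
        using der[of 0 t] t by (simp add: D_def nth_vderiv_0)
      have P: "((\<lambda>t. transpose A + \<Psi> t ** U) has_vector_derivative 0 + D 1 t ** U) (at t)"
        by (intro has_vector_derivative_add has_vector_derivative_const
            bounded_linear.has_vector_derivative[OF bounded_bilinear.bounded_linear_left[OF
                bounded_bilinear_matrix_mult] \<Psi>'])
      have Q: "((\<lambda>t. A + U ** \<Psi> t) has_vector_derivative 0 + U ** D 1 t) (at t)"
        by (intro has_vector_derivative_add has_vector_derivative_const
            bounded_linear.has_vector_derivative[OF bounded_bilinear.bounded_linear_right[OF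
                bounded_bilinear_matrix_mult] \<Psi>'])
      have r': "(r (Suc k) has_vector_derivative 0) (at t)"
        unfolding r_def by simp
      have R: "(?R has_vector_derivative - (0 + (\<Sum>j\<in>{1..<Suc k}. real (Suc k choose j) *\<^sub>R
          (D j t ** U ** D (Suc (Suc k - j)) t + D (Suc j) t ** U ** D (Suc k - j) t)))) (at t)"
        using t by (intro has_vector_derivative_minus has_vector_derivative_add r' has_vector_derivative_sum
            bounded_linear.has_vector_derivative[OF bounded_linear_scaleR_right] prod) auto
      have ev: "\<forall>\<^sub>F s in nhds t. (transpose A + \<Psi> s ** U) ** D (Suc k) s + D (Suc k) s ** (A + U ** \<Psi> s) = ?R s"
        using eventually_nhds_in_open[OF S t]
      proof eventually_elim
        case (elim s)
        have "D 0 = \<Psi>" by (simp add: D_def nth_vderiv_0)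
        then show ?case
          using G[OF elim] sum_atMost_ends[of "Suc k" "\<lambda>j. real (Suc k choose j) *\<^sub>R (D j s ** U ** D (Suc k - j) s)"]
          by (simp add: eq_neg_iff_add_eq_0 bounded_bilinear.add_left[OF bounded_bilinear_matrix_mult]
              bounded_bilinear.add_right[OF bounded_bilinear_matrix_mult] matrix_mul_assoc algebra_simps
              del: sum.atMost_Suc sum.op_ivl_Suc)
      qed
      show ?thesis
        by (rule sylvester_differentiable[OF P Q R ev]) (rule inj[OF t])
    qed
    then have "(D (Suc k) has_vector_derivative D (Suc (Suc k)) t) (at t)" if "t \<in> S" for t
      using that nth_vderiv_has_vector_derivative[of "Suc k" \<Psi> t] by (simp add: D_def)
    then show ?case using G Suc by (auto simp: le_Suc_eq)
  }
qed

text \<open>Since \<open>nth_vderiv\<close> is total, the first conjunct records that the derivative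
  of order \<open>k\<close> is genuine on a neighbourhood of 0. Smoothness of \<open>\<Psi>\<close>
  and \<open>\<Psi> 0 = 0\<close> are derived, not assumed.\<close>

theorem theorem6:
  fixes A :: "real^'n^'n" and B :: "real^'m^'n" and C :: "real^'n^'p"
    and \<Psi> :: "real \<Rightarrow> real^'n^'n" and k :: nat
  assumes "hurwitz A"
    and "\<exists>s. invertible (mat s - complex_mat A) \<and> transfer_function A B C s \<noteq> 0"
    and "\<And>\<theta>. ereal \<theta> < inverse ((hinf_norm (transfer_function A B C))\<^sup>2) \<Longrightarrow>
            stabilising_solution A B C \<theta> (\<Psi> \<theta>)"
    and "k \<ge> 1"
  shows "(\<forall>\<^sub>F \<theta> in nhds 0. nth_vderiv (k - 1) \<Psi> differentiable (at \<theta>)) \<and>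
    nth_vderiv k \<Psi> 0 =
      lyapunov_op (transpose A)
        ((if k = 1 then 1 else 0) *\<^sub>R (transpose C ** C)
         + (\<Sum>j=1..<k. real (k choose j) *\<^sub>R
              (nth_vderiv j \<Psi> 0 ** (B ** transpose B) ** nth_vderiv (k - j) \<Psi> 0)))"
proof -
  let ?U = "B ** transpose B" and ?\<Omega> = "transpose C ** C"
  obtain e where e: "e > 0" "\<And>\<theta>. \<bar>\<theta>\<bar> < e \<Longrightarrow> stabilising_solution A B C \<theta> (\<Psi> \<theta>)"
    using hinf_norm_bound_pos[OF assms(1), of B C] assms(3) by metis
  obtain d where d: "0 < d" "d \<le> e" "\<Psi> 0 = 0" "\<And>\<theta>. \<bar>\<theta>\<bar> < d \<Longrightarrow> isCont \<Psi> \<theta>"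
    using stabilising_solution_continuous[OF assms(1) e] by blast
  define S where "S = ball (0 :: real) d"
  have stab: "stabilising_solution A B C \<theta> (\<Psi> \<theta>)" "isCont \<Psi> \<theta>" if "\<theta> \<in> S" for \<theta>
    using that e(2) d by (auto simp: S_def dist_real_def)
  have "open S" "0 \<in> S" using d(1) by (auto simp: S_def)
  have fam: "(\<forall>t\<in>S. transpose A ** nth_vderiv k \<Psi> t + nth_vderiv k \<Psi> t ** A
        + (if k = 0 then t *\<^sub>R ?\<Omega> else if k = 1 then ?\<Omega> else 0)
        + (\<Sum>j\<le>k. real (k choose j) *\<^sub>R (nth_vderiv j \<Psi> t ** ?U ** nth_vderiv (k - j) \<Psi> t)) = 0)
    \<and> (\<forall>j\<le>k. \<forall>t\<in>S. (nth_vderiv j \<Psi> has_vector_derivative nth_vderiv (Suc j) \<Psi> t) (at t))"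
  proof (rule nth_vderiv_riccati_family[OF \<open>open S\<close>])
    show "transpose ?U = ?U" by (simp add: matrix_transpose_mul)
  qed (use stab in \<open>auto simp: stabilising_solution_def intro: stabilising_solution_riccati\<close>)
  have "\<forall>\<theta>\<in>S. nth_vderiv (k - 1) \<Psi> differentiable (at \<theta>)"
  proof
    fix \<theta> assume "\<theta> \<in> S"
    then have "(nth_vderiv (k - 1) \<Psi> has_vector_derivative nth_vderiv (Suc (k - 1)) \<Psi> \<theta>) (at \<theta>)"
      using fam by simp
    then show "nth_vderiv (k - 1) \<Psi> differentiable (at \<theta>)" by (rule differentiableI_vector)
  qed
  then have "\<forall>\<^sub>F \<theta> in nhds 0. nth_vderiv (k - 1) \<Psi> differentiable (at \<theta>)"
    using eventually_nhds_in_open[OF \<open>open S\<close> \<open>0 \<in> S\<close>] by (auto elim: eventually_mono)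
  \<comment> \<open>At 0 both end terms of the Leibniz sum contain the factor
    \<open>\<Psi> 0 = 0\<close>, so the Sylvester equation reduces to a Lyapunov equation.\<close>
  moreover have "transpose A ** nth_vderiv k \<Psi> 0 + nth_vderiv k \<Psi> 0 ** A
      + ((if k = 1 then 1 else 0) *\<^sub>R ?\<Omega>
         + (\<Sum>j=1..<k. real (k choose j) *\<^sub>R (nth_vderiv j \<Psi> 0 ** ?U ** nth_vderiv (k - j) \<Psi> 0))) = 0"
    using fam \<open>0 \<in> S\<close> assms(4) d(3)
      sum_atMost_ends[OF assms(4), of "\<lambda>j. real (k choose j) *\<^sub>R (nth_vderiv j \<Psi> 0 ** ?U ** nth_vderiv (k - j) \<Psi> 0)"]
    by (auto simp: nth_vderiv_0 bounded_bilinear.zero_left[OF bounded_bilinear_matrix_mult]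
        bounded_bilinear.zero_right[OF bounded_bilinear_matrix_mult] add.assoc)
  then have "lyapunov_op (transpose A) ((if k = 1 then 1 else 0) *\<^sub>R ?\<Omega>
         + (\<Sum>j=1..<k. real (k choose j) *\<^sub>R (nth_vderiv j \<Psi> 0 ** ?U ** nth_vderiv (k - j) \<Psi> 0)))
      = nth_vderiv k \<Psi> 0"
    by (rule lyapunov_op_eqI[OF assms(1)])
  ultimately show ?thesis by simp
qed

end
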